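(* Let $0<\sigma<1$, $3<\alpha\le 4$, and let $f:(0,1]\times[0,\infty)\to[0,\infty)$ be continuous with $\lim_{t\to0^+}f(t,y)=\infty$ for every $y\in[0,\infty)$, and such that $t^\sigma f(t,y)$ is a continuous function on $[0,1]\times[0,\infty)$. Let $N=\max_{0\le t\le1}\int_0^1G(t,s)s^{-\sigma}\,ds$, where $G$ is the Green function given in the context. Assume that there exist constants $0<\lambda\le\frac1N$ and $\tau>0$ such that for all $x,y\in[0,\infty)$ and $t\in[0,1]$ $$t^\sigma|f(t,x)-f(t,y)|\le\frac{\lambda|x-y|}{\left(1+\tau\sqrt{|x-y|}\right)^2}.$$ Then the boundary value problem $$D_{0+}^\alpha u(t)=f(t,u(t)),\quad 0<t<1,\qquad u(0)=u(1)=u'(0)=u'(1)=0,$$ has a unique non-negative solution $u\in C[0,1]$.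
   Context: $D_{0+}^\alpha$ is the Riemann–Liouville fractional derivative: for $3<\alpha<4$, $D_{0+}^\alpha u(t)=\frac{1}{\Gamma(4-\alpha)}\frac{d^4}{dt^4}\int_0^t(t-s)^{3-\alpha}u(s)\,ds$, and for $\alpha=4$, $D_{0+}^4u=u^{(4)}$. The Green function $G:[0,1]\times[0,1]\to\mathbb{R}$ is $$G(t,s)=\begin{cases}\dfrac{(t-s)^{\alpha-1}+(1-s)^{\alpha-2}t^{\alpha-2}\left[(s-t)+(\alpha-2)(1-t)s\right]}{\Gamma(\alpha)},&0\le s\le t\le1,\\[2mm]\dfrac{(1-s)^{\alpha-2}t^{\alpha-2}\left[(s-t)+(\alpha-2)(1-t)s\right]}{\Gamma(\alpha)},&0\le t\le s\le1.\end{cases}$$ It is known that $G$ is continuous on $[0,1]\times[0,1]$ and $G(t,s)>0$ for $t,s\in(0,1)$. The maximum defining $N$ exists. "$t^\sigma f(t,y)$ is continuous on $[0,1]\times[0,\infty)$" means that the function $(t,y)\mapsto t^\sigma f(t,y)$, defined for $t\in(0,1]$, extends continuously to $[0,1]\times[0,\infty)$; at $t=0$ expressions involving $t^\sigma f(t,\cdot)$ are understood as values of this extension. A non-negative solution is a function $u\in C[0,1]$ with $u\ge0$ on $[0,1]$, for which $D_{0+}^\alpha u(t)$ exists and equals $f(t,u(t))$ for all $t\in(0,1)$, and which satisfies the boundary conditions ($u'(0)$, $u'(1)$ being one-sided derivatives). *)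

theory Defs
  imports "HOL-Analysis.Analysis"
begin

definition green :: "real \<Rightarrow> real \<Rightarrow> real \<Rightarrow> real" where
  "green \<alpha> t s =
    (if s \<le> t
     then ((t - s) powr (\<alpha> - 1)
            + (1 - s) powr (\<alpha> - 2) * t powr (\<alpha> - 2) * ((s - t) + (\<alpha> - 2) * (1 - t) * s))
          / Gamma \<alpha>
     else (1 - s) powr (\<alpha> - 2) * t powr (\<alpha> - 2) * ((s - t) + (\<alpha> - 2) * (1 - t) * s)
          / Gamma \<alpha>)"

(* GREATEST is the maximum proper (an attained upper bound), not merely a supremum.
   The convention 0 powr x = 0 affects the integrand only at the null set s = 0. *)
definition green_max :: "real \<Rightarrow> real \<Rightarrow> real" where
  "green_max \<alpha> \<sigma> =
    (GREATEST v. v \<in> (\<lambda>t. integral {0..1} (\<lambda>s. green \<alpha> t s * s powr (- \<sigma>))) ` {0..1})"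

(* "The fourth derivative of g exists at t and equals d."  Since deriv is total, the lower
   derivatives are explicitly required to exist near t. *)
definition has_fourth_derivative :: "(real \<Rightarrow> real) \<Rightarrow> real \<Rightarrow> real \<Rightarrow> bool" where
  "has_fourth_derivative g d t \<longleftrightarrow>
    (\<forall>k<3. \<forall>\<^sub>F x in nhds t. (deriv ^^ k) g field_differentiable at x) \<and>
    ((deriv ^^ 3) g has_real_derivative d) (at t)"

(* "The Riemann-Liouville derivative of order \<alpha> of u exists at t and equals d", for
   3 < \<alpha> \<le> 4.  For \<alpha> = 4 the integral formula is not available (Gamma has a pole at 0). *)
definition has_RL_derivative :: "real \<Rightarrow> (real \<Rightarrow> real) \<Rightarrow> real \<Rightarrow> real \<Rightarrow> bool" where
  "has_RL_derivative \<alpha> u d t \<longleftrightarrow>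
    (if \<alpha> = 4 then has_fourth_derivative u d t
     else \<exists>c. has_fourth_derivative (\<lambda>x. integral {0..x} (\<lambda>s. (x - s) powr (3 - \<alpha>) * u s)) c t
            \<and> d = 1 / Gamma (4 - \<alpha>) * c)"

(* Only the values of u on [0,1] matter. *)
definition nonneg_solution ::
  "real \<Rightarrow> (real \<Rightarrow> real \<Rightarrow> real) \<Rightarrow> (real \<Rightarrow> real) \<Rightarrow> bool" where
  "nonneg_solution \<alpha> f u \<longleftrightarrow>
    continuous_on {0..1} u \<and>
    (\<forall>t\<in>{0..1}. u t \<ge> 0) \<and>
    (\<forall>t\<in>{0<..<1}. has_RL_derivative \<alpha> u (f t (u t)) t) \<and>
    u 0 = 0 \<and> u 1 = 0 \<and>
    (u has_real_derivative 0) (at_right 0) \<and>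
    (u has_real_derivative 0) (at_left 1)"

end

theory Submission
  imports Defs
begin

text \<open>Solutions of the boundary value problem are exactly the fixed points of
  \<open>T u t = \<integral> G(t,s) f(s, u s) ds\<close>. Splitting the Green function shows that \<open>T u\<close> is the fractional
  integral of order \<open>\<alpha>\<close> of the right-hand side plus a combination of \<open>t\<^sup>\<alpha>\<^sup>-\<^sup>2\<close> and \<open>t\<^sup>\<alpha>\<^sup>-\<^sup>1\<close>, so the
  semigroup law for fractional integrals gives the equation and the boundary values. Conversely, the
  difference of two functions with the same Riemann--Liouville derivative is a combination of
  \<open>t\<^sup>\<alpha>\<^sup>-\<^sup>3\<close>, \<open>t\<^sup>\<alpha>\<^sup>-\<^sup>2\<close>, \<open>t\<^sup>\<alpha>\<^sup>-\<^sup>1\<close>, which the boundary conditions force to vanish.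

  In the supremum norm \<open>T\<close> satisfies \<open>d(T u, T v) \<le> \<phi>(d(u, v))\<close> with
  \<open>\<phi>(r) = r / (1 + \<tau> \<surd>r)\<^sup>2\<close>. As \<open>1 / \<surd>(\<phi>(r)) = 1 / \<surd>r + \<tau>\<close>, successive Picard iterates are
  \<open>O(1 / n\<^sup>2)\<close> apart, hence converge uniformly; strictness of \<open>\<phi>(r) < r\<close> gives uniqueness.\<close>

section \<open>Fractional integrals\<close>

text \<open>The Riemann-Liouville integral of order \<open>b\<close> without its factor
  \<open>1 / Gamma b\<close>. This is why the semigroup law below carries a Beta factor and
  differentiation multiplies by an order.\<close>

definition frac_int :: "real \<Rightarrow> (real \<Rightarrow> real) \<Rightarrow> real \<Rightarrow> real" where
  "frac_int b g x = integral {0..x} (\<lambda>s. (x - s) powr (b - 1) * g s)"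

text \<open>Substituting \<open>x = s + (X - s) * t\<close> reduces to the Beta integral on the unit
  interval; the two kernels and the Jacobian together contribute the power \<open>a + b - 1\<close>
  of \<open>X - s\<close>.\<close>

lemma has_integral_Beta_shift:
  fixes a b s X :: real
  assumes "a > 0" "b > 0" "s < X"
  shows "((\<lambda>x. (X - x) powr (a - 1) * (x - s) powr (b - 1)) has_integral
           Beta a b * (X - s) powr (a + b - 1)) {s..X}"
proof -
  let ?d = "X - s"
  have d: "?d > 0" using assms by simp
  have "((\<lambda>t. t powr (b - 1) * (1 - t) powr (a - 1)) has_integral Beta b a) (cbox 0 1)"
    using has_integral_Beta_real[of b a] assms by simp
  from has_integral_affinity'[OF this, of "1 / ?d" "- s / ?d"] d
  have A: "((\<lambda>x. (x / ?d + - s / ?d) powr (b - 1) * (1 - (x / ?d + - s / ?d)) powr (a - 1)) has_integral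
      Beta b a * ?d) (cbox ((0 - - s / ?d) * ?d) ((1 - - s / ?d) * ?d))"
    by (simp add: mult.commute)
  have "(0 - - s / ?d) * ?d = s" "(1 - - s / ?d) * ?d = X" "\<And>x. x / ?d + - s / ?d = (x - s) / ?d"
    using d by (simp_all add: divide_simps)
  from A[unfolded this]
  have "((\<lambda>x. ((x - s) / ?d) powr (b - 1) * (1 - (x - s) / ?d) powr (a - 1)) has_integral
      Beta b a * ?d) {s..X}"
    by simp
  from has_integral_mult_right[OF this, of "?d powr (a + b - 2)"]
  have "((\<lambda>x. ?d powr (a + b - 2) * (((x - s) / ?d) powr (b - 1) * (1 - (x - s) / ?d) powr (a - 1)))
      has_integral ?d powr (a + b - 2) * (Beta b a * ?d)) {s..X}" .
  also have "?d powr (a + b - 2) * (Beta b a * ?d) = Beta a b * ?d powr (a + b - 1)"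
  proof -
    have "?d powr (a + b - 2) * ?d = ?d powr (a + b - 2) * ?d powr 1" using d by simp
    also have "\<dots> = ?d powr (a + b - 1)" using d by (simp only: powr_add[symmetric]) simp
    finally show ?thesis by (simp add: Beta_commute ac_simps)
  qed
  finally show ?thesis
  proof (rule has_integral_eq[rotated])
    fix x assume x: "x \<in> {s..X}"
    have 1: "1 - (x - s) / ?d = (X - x) / ?d" using d by (simp add: field_simps)
    have "a + b - 2 = (a - 1) + (b - 1)" by simp
    then have "?d powr (a + b - 2) = ?d powr (a - 1) * ?d powr (b - 1)"
      by (simp only: powr_add)
    then show "?d powr (a + b - 2) * (((x - s) / ?d) powr (b - 1) * (1 - (x - s) / ?d) powr (a - 1)) =
       (X - x) powr (a - 1) * (x - s) powr (b - 1)"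
      using x d unfolding 1 by (simp add: powr_divide)
  qed
qed

text \<open>Tonelli on the triangle \<open>0 \<le> s \<le> x \<le> X\<close>: integrating the two
  kernels over \<open>x\<close> first leaves a Beta integral. Integrability is assumed, so that the
  law serves bounded kernels (\<open>b \<ge> 1\<close>) as well as singular ones
  (\<open>b < 1\<close>).\<close>

lemma frac_int_frac_int:
  fixes a b X :: real
  assumes ab: "a > 0" "b > 0" and X: "X \<ge> 0"
    and g[measurable]: "g \<in> borel_measurable borel" and g0: "\<And>s. 0 \<le> g s"
    and int_b: "\<And>x. x \<in> {0..X} \<Longrightarrow> (\<lambda>s. (x - s) powr (b - 1) * g s) integrable_on {0..x}"
    and int_ab: "(\<lambda>s. (X - s) powr (a + b - 1) * g s) integrable_on {0..X}"
  shows "((\<lambda>x. (X - x) powr (a - 1) * frac_int b g x) has_integral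
           Beta a b * frac_int (a + b) g X) {0..X}"
proof -
  \<comment> \<open>Extending the integrand by zero from the triangle to the plane lets both
    iterated integrals run over \<open>lborel\<close>.\<close>
  define K where "K x s = indicator {0..X} x * (indicator {0..x} s *
      ((X - x) powr (a - 1) * ((x - s) powr (b - 1) * g s)))" for x s :: real
  have K0: "K x s \<ge> 0" for x s unfolding K_def using g0 by (auto simp: indicator_def)
  have Keq: "K x s = (if 0 \<le> x \<and> x \<le> X \<and> 0 \<le> s \<and> s \<le> x then
      (X - x) powr (a - 1) * ((x - s) powr (b - 1) * g s) else 0)" for x s
    unfolding K_def by (auto simp: indicator_def)
  have Km[measurable]: "(\<lambda>(x, s). K x s) \<in> borel_measurable (borel \<Otimes>\<^sub>M borel)"
    unfolding Keq by measurable
  have inner1: "(\<integral>\<^sup>+s. ennreal (K x s) \<partial>lborel) =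
      ennreal (indicator {0..X} x * ((X - x) powr (a - 1) * frac_int b g x))" for x
  proof (cases "x \<in> {0..X}")
    case True
    have "((\<lambda>s. (X - x) powr (a - 1) * ((x - s) powr (b - 1) * g s)) has_integral
        (X - x) powr (a - 1) * frac_int b g x) {0..x}"
      unfolding frac_int_def
      by (intro has_integral_mult_right integrable_integral int_b True)
    then have "((\<lambda>s. if s \<in> {0..x} then (X - x) powr (a - 1) * ((x - s) powr (b - 1) * g s) else 0)
        has_integral (X - x) powr (a - 1) * frac_int b g x) UNIV"
      by (simp only: has_integral_restrict_UNIV)
    then have "(K x has_integral (X - x) powr (a - 1) * frac_int b g x) UNIV"
      by (rule has_integral_eq[rotated]) (use True in \<open>auto simp: Keq\<close>)
    from nn_integral_has_integral_lborel[OF _ _ this] K0 show ?thesis using True by simp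
  qed (simp add: K_def)
  \<comment> \<open>The point \<open>s = X\<close> is excluded because the Beta integral above is
    stated for \<open>s < X\<close>; a null set does not affect the outer integral.\<close>
  have inner2: "(\<integral>\<^sup>+x. ennreal (K x s) \<partial>lborel) =
      ennreal (indicator {0..X} s * (Beta a b * ((X - s) powr (a + b - 1) * g s)))"
    if "s \<noteq> X" for s
  proof (cases "s \<in> {0..X}")
    case True
    then have "s < X" using that by auto
    from has_integral_mult_left[OF has_integral_Beta_shift[OF ab this], of "g s"]
    have "((\<lambda>x. if x \<in> {s..X} then (X - x) powr (a - 1) * (x - s) powr (b - 1) * g s else 0)
        has_integral Beta a b * (X - s) powr (a + b - 1) * g s) UNIV"
      by (simp only: has_integral_restrict_UNIV)
    then have "((\<lambda>x. K x s) has_integral Beta a b * (X - s) powr (a + b - 1) * g s) UNIV"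
      by (rule has_integral_eq[rotated]) (use True in \<open>auto simp: Keq\<close>)
    from nn_integral_has_integral_lborel[OF _ _ this] K0 show ?thesis using True
      by (simp add: ac_simps)
  next
    case False
    then have "K x s = 0" for x by (auto simp: Keq)
    then show ?thesis using False by simp
  qed
  have "((\<lambda>s. Beta a b * ((X - s) powr (a + b - 1) * g s)) has_integral
        Beta a b * frac_int (a + b) g X) {0..X}"
      unfolding frac_int_def
      by (intro has_integral_mult_right integrable_integral int_ab)
  then have "((\<lambda>s. if s \<in> {0..X} then Beta a b * ((X - s) powr (a + b - 1) * g s) else 0)
      has_integral Beta a b * frac_int (a + b) g X) UNIV"
    by (simp only: has_integral_restrict_UNIV)
  then have "((\<lambda>s. indicator {0..X} s * (Beta a b * ((X - s) powr (a + b - 1) * g s)))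
      has_integral Beta a b * frac_int (a + b) g X) UNIV"
    by (rule has_integral_eq[rotated]) (auto simp: indicator_def)
  have Bp: "Beta a b > 0" using ab unfolding Beta_def by (simp add: Gamma_real_pos)
  have fp: "frac_int (a + b) g X \<ge> 0" unfolding frac_int_def
    by (intro integral_nonneg int_ab) (use g0 in auto)
  have outer2: "(\<integral>\<^sup>+s. ennreal (indicator {0..X} s * (Beta a b * ((X - s) powr (a + b - 1) * g s)))
      \<partial>lborel) = ennreal (Beta a b * frac_int (a + b) g X)"
  proof (rule nn_integral_has_integral_lborel)
    show "indicator {0..X} s * (Beta a b * ((X - s) powr (a + b - 1) * g s)) \<ge> 0" for s
      using g0 Bp by simp
  qed (measurable, fact)
  have tot: "(\<integral>\<^sup>+x. \<integral>\<^sup>+s. ennreal (K x s) \<partial>lborel \<partial>lborel) =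
      ennreal (Beta a b * frac_int (a + b) g X)"
  proof -
    have "(\<integral>\<^sup>+x. \<integral>\<^sup>+s. ennreal (K x s) \<partial>lborel \<partial>lborel) =
        (\<integral>\<^sup>+s. \<integral>\<^sup>+x. ennreal (K x s) \<partial>lborel \<partial>lborel)"
      by (rule lborel_pair.Fubini') measurable
    also have "\<dots> = (\<integral>\<^sup>+s. ennreal (indicator {0..X} s * (Beta a b * ((X - s) powr (a + b - 1) * g s)))
      \<partial>lborel)"
      by (intro nn_integral_cong_AE) (use AE_lborel_singleton[of X] in \<open>auto intro: inner2\<close>)
    finally show ?thesis using outer2 by simp
  qed
  let ?F = "\<lambda>x. indicator {0..X} x * ((X - x) powr (a - 1) * frac_int b g x)"
  have F0: "?F x \<ge> 0" for x
  proof -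
    have "x \<in> {0..X} \<Longrightarrow> frac_int b g x \<ge> 0" unfolding frac_int_def
      by (intro integral_nonneg int_b) (use g0 in auto)
    then show ?thesis by (auto simp: indicator_def)
  qed
  \<comment> \<open>Measurability of the inner fractional integral is derived by reading it as a
    parametrised Lebesgue integral of the measurable \<open>K\<close>.\<close>
  have "?F = (\<lambda>x. enn2real (\<integral>\<^sup>+s. ennreal (K x s) \<partial>lborel))"
    unfolding inner1 using F0 by (intro ext) (simp only: enn2real_ennreal)
  moreover have "(\<lambda>x. enn2real (\<integral>\<^sup>+s. ennreal (K x s) \<partial>lborel)) \<in> borel_measurable borel"
    by measurable
  ultimately have Fm: "?F \<in> borel_measurable borel" by (simp only:)
  have "(?F has_integral Beta a b * frac_int (a + b) g X) UNIV"
  proof (intro nn_integral_has_integral Fm F0)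
    show "(\<integral>\<^sup>+x. ennreal (?F x) \<partial>lborel) = ennreal (Beta a b * frac_int (a + b) g X)"
      using tot unfolding inner1 .
  qed (use Bp fp in simp)
  then have "((\<lambda>x. if x \<in> {0..X} then (X - x) powr (a - 1) * frac_int b g x else 0)
      has_integral Beta a b * frac_int (a + b) g X) UNIV"
    by (rule has_integral_eq[rotated]) (auto simp: indicator_def)
  then show ?thesis by (simp only: has_integral_restrict_UNIV)
qed

section \<open>Fractional integrals of nonnegative integrable functions\<close>

lemma integrable_mult_bounded_borel:
  fixes k w :: "real \<Rightarrow> real"
  assumes w: "w integrable_on {a..b}" "\<And>s. s \<in> {a..b} \<Longrightarrow> 0 \<le> w s"
    and [measurable]: "k \<in> borel_measurable borel" and bd: "\<And>s. s \<in> {a..b} \<Longrightarrow> \<bar>k s\<bar> \<le> B"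
  shows "(\<lambda>s. k s * w s) integrable_on {a..b}"
proof -
  \<comment> \<open>Nonnegativity upgrades integrability to absolute integrability, which survives
    multiplication by a bounded measurable factor.\<close>
  have "w absolutely_integrable_on {a..b}"
    by (intro nonnegative_absolutely_integrable_1 w)
  moreover have "k \<in> borel_measurable (lebesgue_on {a..b})"
    by (intro measurable_restrict_space1 measurable_completion) measurable
  moreover have "bounded (k ` {a..b})"
    using bd by (auto simp: bounded_iff intro!: exI[of _ B])
  ultimately have "(\<lambda>s. k s * w s) absolutely_integrable_on {a..b}"
    by (intro absolutely_integrable_bounded_measurable_product_real) auto
  then show ?thesis by (rule set_lebesgue_integral_eq_integral(1))
qed

text \<open>Meant for the right-hand side \<open>f s (u s)\<close>, which may blow up like
  \<open>s powr (- \<sigma>)\<close> at 0. Sign and Borel measurability are imposed on the whole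
  line, as Tonelli's theorem is applied over \<open>lborel\<close>.\<close>

locale nonneg_integrable =
  fixes g :: "real \<Rightarrow> real"
  assumes borel_g [measurable]: "g \<in> borel_measurable borel"
    and nonneg_g: "\<And>s. 0 \<le> g s"
    and integrable_g: "g integrable_on {0..1}"
begin

lemma integrable_mult_bounded:
  fixes k :: "real \<Rightarrow> real"
  assumes [measurable]: "k \<in> borel_measurable borel" and x: "x \<in> {0..1}"
    and bd: "\<And>s. s \<in> {0..x} \<Longrightarrow> \<bar>k s\<bar> \<le> B"
  shows "(\<lambda>s. k s * g s) integrable_on {0..x}"
  by (intro integrable_mult_bounded_borel integrable_on_subinterval[OF integrable_g])
    (use x nonneg_g bd in auto)

lemma integrable_kernel:
  assumes "x \<in> {0..1}" "b \<ge> 1"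
  shows "(\<lambda>s. (x - s) powr (b - 1) * g s) integrable_on {0..x}"
proof (rule integrable_mult_bounded)
  fix s assume "s \<in> {0..x}"
  then have "(x - s) powr (b - 1) \<le> 1 powr (b - 1)"
    using assms by (intro powr_mono2) auto
  then show "\<bar>(x - s) powr (b - 1)\<bar> \<le> 1" by simp
qed (use assms in measurable)

lemma frac_int_semigroup:
  assumes "a > 0" "b \<ge> 1" "x \<in> {0..1}"
  shows "((\<lambda>y. (x - y) powr (a - 1) * frac_int b g y) has_integral
           Beta a b * frac_int (a + b) g x) {0..x}"
proof (rule frac_int_frac_int)
  show "(\<lambda>s. (x - s) powr (a + b - 1) * g s) integrable_on {0..x}"
    by (rule integrable_kernel) (use assms in auto)
  show "(\<lambda>s. (y - s) powr (b - 1) * g s) integrable_on {0..y}" if "y \<in> {0..x}" for y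
    by (rule integrable_kernel) (use assms that in auto)
qed (use assms nonneg_g in auto)

text \<open>The semigroup law with outer order 1, where \<open>Beta 1 b = 1 / b\<close>.\<close>

lemma frac_int_Suc:
  assumes "b \<ge> 1" "x \<in> {0..1}"
  shows "(frac_int b g has_integral frac_int (b + 1) g x / b) {0..x}"
proof -
  have "b \<notin> \<int>\<^sub>\<le>\<^sub>0" "Gamma b > 0"
    using assms by (auto elim!: nonpos_Ints_cases)
  then have "Beta 1 b = 1 / b"
    by (simp add: Beta_def add.commute[of 1 b] Gamma_plus1)
  then have "((\<lambda>y. (x - y) powr (1 - 1) * frac_int b g y) has_integral frac_int (b + 1) g x / b) {0..x}"
    using frac_int_semigroup[of 1 b x] assms by (simp add: add.commute)
  \<comment> \<open>The kernel \<open>(x - y) powr 0\<close> is 1 except at \<open>y = x\<close>,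
    where \<open>0 powr 0 = 0\<close>.\<close>
  then show ?thesis
    by (rule has_integral_spike_finite[where S="{x}", rotated -1]) auto
qed

lemma frac_int_1: "x \<in> {0..1} \<Longrightarrow> frac_int 1 g x = integral {0..x} g"
  unfolding frac_int_def by (rule integral_spike[where S="{x}"]) auto

text \<open>Order 1 is an indefinite integral. For \<open>b \<ge> 2\<close>, order \<open>b\<close>
  is \<open>b - 1\<close> times the indefinite integral of order
  \<open>b - 1 \<ge> 1\<close>.\<close>

lemma continuous_frac_int:
  assumes "b = 1 \<or> b \<ge> 2"
  shows "continuous_on {0..1} (frac_int b g)"
proof (cases "b = 1")
  case True
  show ?thesis unfolding True
    using indefinite_integral_continuous_1[OF integrable_g]
    by (subst continuous_on_cong[OF refl frac_int_1])
next
  case False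
  with assms have b: "b - 1 \<ge> 1" by auto
  have "continuous_on {0..1} (\<lambda>x. (b - 1) * integral {0..x} (frac_int (b - 1) g))"
    using frac_int_Suc[OF b, of 1]
    by (intro continuous_intros indefinite_integral_continuous_1) auto
  then show ?thesis
  proof (rule continuous_on_eq)
    fix x :: real assume "x \<in> {0..1}"
    then show "(b - 1) * integral {0..x} (frac_int (b - 1) g) = frac_int b g x"
      using integral_unique[OF frac_int_Suc[OF b, of x]] b by simp
  qed
qed

text \<open>The fundamental theorem of calculus applied to \<open>frac_int_Suc\<close>. Derivatives
  within the closed interval include the endpoints, where the boundary conditions live.\<close>

lemma frac_int_has_derivative:
  assumes b: "b = 1 \<or> b \<ge> 2" and x: "x \<in> {0..1}"
  shows "(frac_int (b + 1) g has_real_derivative b * frac_int b g x) (at x within {0..1})"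
proof -
  have "((\<lambda>x. b * integral {0..x} (frac_int b g)) has_real_derivative b * frac_int b g x)
      (at x within {0..1})"
    by (intro DERIV_cmult integral_has_real_derivative continuous_frac_int assms)
  then show ?thesis
  proof (rule has_field_derivative_transform_within[OF _ zero_less_one x])
    fix y :: real assume "y \<in> {0..1}"
    then show "b * integral {0..y} (frac_int b g) = frac_int (b + 1) g y"
      using integral_unique[OF frac_int_Suc[of b y]] b by auto
  qed
qed

text \<open>At order 1 the integrand is \<open>g\<close> itself, possibly singular at 0, so the
  fundamental theorem is used pointwise at an interior point of continuity.\<close>

lemma frac_int_1_has_derivative:
  assumes x: "x \<in> {0<..<1}" and "isCont g x"
  shows "(frac_int 1 g has_real_derivative g x) (at x)"
proof -
  have "((\<lambda>u. integral {0..u} g) has_vector_derivative g x) (at x within {0..1} - {})"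
    by (rule integral_has_vector_derivative_continuous_at[OF integrable_g])
      (use assms continuous_at_imp_continuous_at_within in auto)
  then have "((\<lambda>u. integral {0..u} g) has_real_derivative g x) (at x within {0..1})"
    by (simp add: has_real_derivative_iff_has_vector_derivative)
  then have "(frac_int 1 g has_real_derivative g x) (at x within {0..1})"
    by (rule has_field_derivative_transform_within[OF _ zero_less_one]) (use x in \<open>auto simp: frac_int_1\<close>)
  then show ?thesis using x by (simp add: at_within_Icc_at)
qed

end

section \<open>The Green function\<close>

lemma continuous_on_powr_unit:
  fixes c :: real
  assumes "c > 0"
  shows "continuous_on {0..1} (\<lambda>t. t powr c)"
  using assms by (intro continuous_on_powr' continuous_intros) auto

section \<open>Nonnegativity of the Green function\<close>

lemma powr_diff_le:
  fixes a b p :: real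
  assumes "0 < a" "a \<le> b" "p \<ge> 1"
  shows "b powr p - a powr p \<le> p * b powr (p - 1) * (b - a)"
proof (cases "a = b")
  case False
  with assms have "a < b" by simp
  moreover have "((\<lambda>x. x powr p) has_real_derivative p * z powr (p - 1)) (at z)" if "a \<le> z" for z
    using assms that by (intro has_real_derivative_powr) auto
  ultimately obtain z where z: "a < z" "z < b"
      and eq: "b powr p - a powr p = (b - a) * (p * z powr (p - 1))"
    using MVT2[of a b "\<lambda>x. x powr p" "\<lambda>z. p * z powr (p - 1)"] by blast
  have "z powr (p - 1) \<le> b powr (p - 1)"
    using z assms by (intro powr_mono2) auto
  then have "p * z powr (p - 1) \<le> p * b powr (p - 1)"
    using assms by (intro mult_left_mono) auto
  then have "(b - a) * (p * z powr (p - 1)) \<le> (b - a) * (p * b powr (p - 1))"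
    using assms by (intro mult_left_mono) auto
  then show ?thesis unfolding eq by (simp add: ac_simps)
qed simp

text \<open>Multiply the mean value bound for \<open>b powr p - a powr p\<close> by
  \<open>a\<close>, then enlarge that factor to \<open>b\<close>. This is the Green function
  inequality below the diagonal, with \<open>a = t - s\<close>, \<open>b = t * (1 - s)\<close>,
  \<open>p = \<alpha> - 2\<close>.\<close>

lemma powr_diff_times_le:
  fixes a b p :: real
  assumes "0 \<le> a" "a \<le> b" "p \<ge> 1"
  shows "a * b powr p \<le> a powr (p + 1) + p * b powr p * (b - a)"
proof (cases "a = 0")
  case False
  then have pos: "a > 0" "b > 0" using assms by auto
  have *: "b powr p = b * b powr (p - 1)" "a powr (p + 1) = a * a powr p"
    using pos by (simp_all add: powr_mult_base add.commute)
  have "a * (b powr p - a powr p) \<le> a * (p * b powr (p - 1) * (b - a))"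
    using powr_diff_le[of a b p] assms pos by (intro mult_left_mono) auto
  also have "\<dots> \<le> b * (p * b powr (p - 1) * (b - a))"
    using assms by (intro mult_right_mono mult_nonneg_nonneg) auto
  also have "\<dots> = p * b powr p * (b - a)" by (simp add: *(1))
  finally show ?thesis by (simp only: *(2)) (simp add: algebra_simps)
qed (use assms in simp)

text \<open>For \<open>s \<le> t\<close>, put \<open>a = t - s\<close>,
  \<open>b = t * (1 - s)\<close>, \<open>p = \<alpha> - 2\<close>; then
  \<open>b - a = s * (1 - t)\<close> and the numerator is
  \<open>a powr (p + 1) + b powr p * (p * (b - a) - a)\<close>. For \<open>s > t\<close> every
  factor is visibly nonnegative.\<close>

lemma green_nonneg:
  assumes "\<alpha> \<ge> 3" "t \<in> {0..1}" "s \<in> {0..1}"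
  shows "0 \<le> green \<alpha> t s"
proof -
  have G: "Gamma \<alpha> > 0" using assms by (intro Gamma_real_pos) auto
  show ?thesis
  proof (cases "s \<le> t")
    case True
    let ?a = "t - s" and ?b = "t * (1 - s)" and ?p = "\<alpha> - 2"
    have ba: "?b - ?a = s * (1 - t)" by (simp add: algebra_simps)
    moreover have "s * (1 - t) \<ge> 0" using assms by (intro mult_nonneg_nonneg) auto
    ultimately have "?a \<le> ?b" by linarith
    then have "?a * ?b powr ?p \<le> ?a powr (?p + 1) + ?p * ?b powr ?p * (?b - ?a)"
      using True assms by (intro powr_diff_times_le) auto
    moreover have "?b powr ?p = (1 - s) powr ?p * t powr ?p"
      using assms by (simp add: powr_mult mult.commute)
    ultimately have "0 \<le> ?a powr (\<alpha> - 1) + (1 - s) powr ?p * t powr ?p * ((s - t) + ?p * (1 - t) * s)"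
      unfolding ba by (simp add: algebra_simps)
    then show ?thesis using True G by (simp add: green_def)
  next
    case False
    then show ?thesis using assms G
      by (auto simp: green_def intro!: divide_nonneg_pos mult_nonneg_nonneg add_nonneg_nonneg)
  qed
qed

text \<open>Separates the variables: a convolution kernel, plus two powers of \<open>t\<close> whose
  coefficients depend on \<open>s\<close> alone.\<close>

lemma green_decompose:
  assumes "t \<ge> 0"
  shows "green \<alpha> t s = ((if s \<le> t then (t - s) powr (\<alpha> - 1) else 0)
     + (\<alpha> - 1) * ((1 - s) powr (\<alpha> - 2) * s) * t powr (\<alpha> - 2)
     - (1 - s) powr (\<alpha> - 2) * (1 + (\<alpha> - 2) * s) * t powr (\<alpha> - 1)) / Gamma \<alpha>"
proof -
  have "t powr (\<alpha> - 1) = t * t powr (\<alpha> - 2)"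
    using powr_mult_base[OF assms, of "\<alpha> - 2"] by simp
  then have "(1 - s) powr (\<alpha> - 2) * t powr (\<alpha> - 2) * ((s - t) + (\<alpha> - 2) * (1 - t) * s) =
     (\<alpha> - 1) * ((1 - s) powr (\<alpha> - 2) * s) * t powr (\<alpha> - 2)
     - (1 - s) powr (\<alpha> - 2) * (1 + (\<alpha> - 2) * s) * t powr (\<alpha> - 1)"
    by (simp add: algebra_simps)
  then show ?thesis unfolding green_def by simp
qed

section \<open>The Green operator as a fractional integral plus two powers\<close>

definition green_op :: "real \<Rightarrow> (real \<Rightarrow> real) \<Rightarrow> real \<Rightarrow> real" where
  "green_op \<alpha> g t = integral {0..1} (\<lambda>s. green \<alpha> t s * g s)"

text \<open>The coefficient of \<open>t powr (\<alpha> - 2)\<close> in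
  \<open>Gamma \<alpha> * green_op \<alpha> g t\<close>; \<open>green_coeff1\<close> is that of
  \<open>t powr (\<alpha> - 1)\<close>.\<close>

definition green_coeff2 :: "real \<Rightarrow> (real \<Rightarrow> real) \<Rightarrow> real" where
  "green_coeff2 \<alpha> g = (\<alpha> - 1) * integral {0..1} (\<lambda>s. (1 - s) powr (\<alpha> - 2) * s * g s)"

definition green_coeff1 :: "real \<Rightarrow> (real \<Rightarrow> real) \<Rightarrow> real" where
  "green_coeff1 \<alpha> g = - integral {0..1} (\<lambda>s. (1 - s) powr (\<alpha> - 2) * (1 + (\<alpha> - 2) * s) * g s)"

context nonneg_integrable
begin

lemma integrable_at_1:
  assumes "\<alpha> \<ge> 3"
  shows "(\<lambda>s. (1 - s) powr (\<alpha> - 2) * g s) integrable_on {0..1}"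
    and "(\<lambda>s. (1 - s) powr (\<alpha> - 2) * s * g s) integrable_on {0..1}"
    and "(\<lambda>s. (1 - s) powr (\<alpha> - 2) * (1 + (\<alpha> - 2) * s) * g s) integrable_on {0..1}"
proof -
  have p: "(1 - s) powr (\<alpha> - 2) \<le> 1" if "s \<in> {0..1}" for s
  proof -
    have "(1 - s) powr (\<alpha> - 2) \<le> 1 powr (\<alpha> - 2)"
      using assms that by (intro powr_mono2) auto
    then show ?thesis by simp
  qed
  show "(\<lambda>s. (1 - s) powr (\<alpha> - 2) * g s) integrable_on {0..1}"
    using integrable_kernel[of 1 "\<alpha> - 1"] assms by simp
  show *: "(\<lambda>s. (1 - s) powr (\<alpha> - 2) * s * g s) integrable_on {0..1}"
  proof (rule integrable_mult_bounded)
    show "\<bar>(1 - s) powr (\<alpha> - 2) * s\<bar> \<le> 1" if "s \<in> {0..1}" for s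
      using p[OF that] that by (auto simp: abs_mult intro!: mult_le_one)
  qed auto
  have "(\<lambda>s. (1 - s) powr (\<alpha> - 2) * g s + (\<alpha> - 2) * ((1 - s) powr (\<alpha> - 2) * s * g s)) integrable_on {0..1}"
    by (intro integrable_add integrable_on_mult_right *) fact
  then show "(\<lambda>s. (1 - s) powr (\<alpha> - 2) * (1 + (\<alpha> - 2) * s) * g s) integrable_on {0..1}"
    by (simp add: algebra_simps)
qed

lemma green_has_integral:
  assumes \<alpha>: "\<alpha> \<ge> 3" and t: "t \<in> {0..1}"
  shows "((\<lambda>s. green \<alpha> t s * g s) has_integral
     (frac_int \<alpha> g t + green_coeff2 \<alpha> g * t powr (\<alpha> - 2) + green_coeff1 \<alpha> g * t powr (\<alpha> - 1))
       / Gamma \<alpha>) {0..1}"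
proof -
  have 1: "((\<lambda>s. if s \<in> {0..t} then (t - s) powr (\<alpha> - 1) * g s else 0) has_integral frac_int \<alpha> g t) {0..1}"
    unfolding frac_int_def
    by (subst has_integral_restrict) (use t \<alpha> integrable_kernel[OF t, of \<alpha>] in \<open>auto intro!: integrable_integral\<close>)
  have 2: "((\<lambda>s. (\<alpha> - 1) * ((1 - s) powr (\<alpha> - 2) * s * g s)) has_integral green_coeff2 \<alpha> g) {0..1}"
    unfolding green_coeff2_def
    by (intro has_integral_mult_right integrable_integral integrable_at_1 \<alpha>)
  have 3: "((\<lambda>s. - ((1 - s) powr (\<alpha> - 2) * (1 + (\<alpha> - 2) * s) * g s)) has_integral green_coeff1 \<alpha> g) {0..1}"
    unfolding green_coeff1_def
    by (intro has_integral_neg integrable_integral integrable_at_1 \<alpha>)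
  from has_integral_divide[OF has_integral_add[OF has_integral_add[OF 1
      has_integral_mult_left[OF 2, of "t powr (\<alpha> - 2)"]]
      has_integral_mult_left[OF 3, of "t powr (\<alpha> - 1)"]], of "Gamma \<alpha>"]
  show ?thesis
  proof (rule has_integral_eq[rotated])
    fix s :: real assume "s \<in> {0..1}"
    then show "((if s \<in> {0..t} then (t - s) powr (\<alpha> - 1) * g s else 0) +
          (\<alpha> - 1) * ((1 - s) powr (\<alpha> - 2) * s * g s) * t powr (\<alpha> - 2) +
          - ((1 - s) powr (\<alpha> - 2) * (1 + (\<alpha> - 2) * s) * g s) * t powr (\<alpha> - 1)) / Gamma \<alpha> =
          green \<alpha> t s * g s"
      using t green_decompose[of t \<alpha> s] by (simp add: ring_distribs)
  qed
qed

lemma green_op_eq: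
  assumes "\<alpha> \<ge> 3" "t \<in> {0..1}"
  shows "green_op \<alpha> g t =
    (frac_int \<alpha> g t + green_coeff2 \<alpha> g * t powr (\<alpha> - 2) + green_coeff1 \<alpha> g * t powr (\<alpha> - 1)) / Gamma \<alpha>"
  unfolding green_op_def by (rule integral_unique[OF green_has_integral[OF assms]])

lemma green_op_nonneg:
  assumes "\<alpha> \<ge> 3" "t \<in> {0..1}"
  shows "0 \<le> green_op \<alpha> g t"
  unfolding green_op_def
  by (intro integral_nonneg has_integral_integrable[OF green_has_integral] mult_nonneg_nonneg green_nonneg nonneg_g)
    (use assms in auto)

lemma continuous_green_op:
  assumes "\<alpha> \<ge> 3"
  shows "continuous_on {0..1} (green_op \<alpha> g)"
proof -
  have "continuous_on {0..1} (\<lambda>t. (frac_int \<alpha> g t + green_coeff2 \<alpha> g * t powr (\<alpha> - 2)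
      + green_coeff1 \<alpha> g * t powr (\<alpha> - 1)) / Gamma \<alpha>)"
  proof -
    have "Gamma \<alpha> \<noteq> 0" using Gamma_real_pos[of \<alpha>] assms by linarith
    then show ?thesis using assms
      by (intro continuous_on_add continuous_on_mult continuous_on_divide continuous_on_const
          continuous_frac_int continuous_on_powr_unit) auto
  qed
  then show ?thesis
    by (rule continuous_on_eq) (simp add: green_op_eq[OF assms])
qed

end

text \<open>Trades iterated \<open>deriv\<close> for an explicit chain of derivatives. The chain
  must hold on an open set, since each \<open>deriv\<close> has to be identified near a point before
  it can be differentiated there; the last derivative is taken at \<open>t\<close> alone.\<close>

lemma has_fourth_derivativeI:
  fixes F F1 F2 F3 f :: "real \<Rightarrow> real"
  assumes S: "open S" "t \<in> S" and eq: "\<And>x. x \<in> S \<Longrightarrow> F x = f x"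
    and 1: "\<And>x. x \<in> S \<Longrightarrow> (F has_real_derivative F1 x) (at x)"
    and 2: "\<And>x. x \<in> S \<Longrightarrow> (F1 has_real_derivative F2 x) (at x)"
    and 3: "\<And>x. x \<in> S \<Longrightarrow> (F2 has_real_derivative F3 x) (at x)"
    and 4: "(F3 has_real_derivative d) (at t)"
  shows "has_fourth_derivative f d t"
proof -
  note tr = has_field_derivative_transform_within_open[OF _ S(1)]
  have d0: "(f has_real_derivative F1 x) (at x)" if "x \<in> S" for x
    by (rule tr[OF 1]) (use that eq in auto)
  have e1: "F1 x = deriv f x" if "x \<in> S" for x
    using DERIV_imp_deriv[OF d0[OF that]] by simp
  have d1: "(deriv f has_real_derivative F2 x) (at x)" if "x \<in> S" for x
    by (rule tr[OF 2]) (use that e1 in auto)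
  have e2: "F2 x = deriv (deriv f) x" if "x \<in> S" for x
    using DERIV_imp_deriv[OF d1[OF that]] by simp
  have d2: "(deriv (deriv f) has_real_derivative F3 x) (at x)" if "x \<in> S" for x
    by (rule tr[OF 3]) (use that e2 in auto)
  have e3: "F3 x = deriv (deriv (deriv f)) x" if "x \<in> S" for x
    using DERIV_imp_deriv[OF d2[OF that]] by simp
  have d3: "(deriv (deriv (deriv f)) has_real_derivative d) (at t)"
    by (rule tr[OF 4]) (use S e3 in auto)
  have "\<forall>\<^sub>F x in nhds t. (deriv ^^ k) f field_differentiable at x" if "k < 3" for k
  proof -
    have "k = 0 \<or> k = 1 \<or> k = 2" using that by auto
    then have "(deriv ^^ k) f field_differentiable at x" if "x \<in> S" for x
      using d0[OF that] d1[OF that] d2[OF that]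
      by (auto simp: field_differentiable_def numeral_2_eq_2)
    then show ?thesis using S eventually_nhds by blast
  qed
  then show ?thesis using d3 by (simp add: has_fourth_derivative_def numeral_3_eq_3)
qed

lemma has_fourth_derivativeD:
  assumes "has_fourth_derivative f d t"
  shows "(f has_real_derivative deriv f t) (at t)"
    and "(deriv f has_real_derivative deriv (deriv f) t) (at t)"
    and "(deriv (deriv f) has_real_derivative deriv (deriv (deriv f)) t) (at t)"
    and "(deriv (deriv (deriv f)) has_real_derivative d) (at t)"
proof -
  have *: "(deriv ^^ k) f field_differentiable at t" if "k < 3" for k
    using assms that unfolding has_fourth_derivative_def by (meson eventually_nhds_x_imp_x)
  show "(f has_real_derivative deriv f t) (at t)"
    using *[of 0] by (simp add: DERIV_deriv_iff_field_differentiable)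
  show "(deriv f has_real_derivative deriv (deriv f) t) (at t)"
    using *[of 1] by (simp add: DERIV_deriv_iff_field_differentiable)
  show "(deriv (deriv f) has_real_derivative deriv (deriv (deriv f)) t) (at t)"
    using *[of 2] by (simp add: DERIV_deriv_iff_field_differentiable numeral_2_eq_2)
  show "(deriv (deriv (deriv f)) has_real_derivative d) (at t)"
    using assms unfolding has_fourth_derivative_def by (simp add: numeral_3_eq_3)
qed

text \<open>With \<open>a = 4 - \<alpha>\<close> this sends the powers \<open>\<alpha> - 3\<close>,
  \<open>\<alpha> - 2\<close>, \<open>\<alpha> - 1\<close> to multiples of \<open>x\<close>,
  \<open>x ^ 2\<close>, \<open>x ^ 3\<close>, which a fourth derivative annihilates.\<close>

lemma has_integral_powr_convolution:
  fixes a b x :: real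
  assumes "a > 0" "b > 0" "x \<ge> 0"
  shows "((\<lambda>s. (x - s) powr (a - 1) * s powr (b - 1)) has_integral
           Beta a b * x powr (a + b - 1)) {0..x}"
  using has_integral_Beta_shift[of a b 0 x] assms by (cases "x = 0") auto

text \<open>The difference quotient at 0 is \<open>t powr (c - 1)\<close>, which tends to 0 because
  \<open>c > 1\<close>.\<close>

lemma powr_has_derivative_0:
  fixes c :: real
  assumes "c > 1"
  shows "((\<lambda>t. t powr c) has_real_derivative 0) (at 0 within {0..1})"
proof -
  have "continuous_on {0..1} (\<lambda>t::real. t powr (c - 1))"
    using assms by (intro continuous_on_powr_unit) auto
  then have "((\<lambda>t::real. t powr (c - 1)) \<longlongrightarrow> 0 powr (c - 1)) (at 0 within {0..1})"
    unfolding continuous_on_def by (rule bspec) simp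
  moreover have "\<forall>\<^sub>F t in at 0 within {0..1}. t powr (c - 1) = (t powr c - 0 powr c) / (t - 0)"
    unfolding eventually_at_filter
    by (rule always_eventually) (auto simp: powr_diff)
  ultimately show ?thesis
    unfolding has_field_derivative_iff by (simp add: tendsto_cong)
qed

section \<open>The Green operator solves the linear boundary value problem\<close>

context nonneg_integrable
begin

text \<open>Differentiating \<open>frac_int 4 g\<close> lowers the order with factors 3, 2, 1,
  whence the 6. Continuity of \<open>g\<close> enters at the last step, from order 1 to
  \<open>g\<close>.\<close>

lemma frac_int_4_fourth_derivative:
  assumes cont: "\<And>x. x \<in> {0<..<1} \<Longrightarrow> isCont g x" and t: "t \<in> {0<..<1}"
    and f: "\<And>x. x \<in> {0<..<1} \<Longrightarrow> f x = c * frac_int 4 g x + p * x ^ 2 + q * x ^ 3"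
  shows "has_fourth_derivative f (6 * c * g t) t"
proof -
  have D: "(frac_int (b + 1) g has_real_derivative b * frac_int b g x) (at x)"
    if "b = 1 \<or> b \<ge> 2" "x \<in> {0<..<1}" for b x
    using frac_int_has_derivative[of b x] that by (auto simp: at_within_Icc_at)
  have D3: "(frac_int 4 g has_real_derivative 3 * frac_int 3 g x) (at x)"
    and D2: "(frac_int 3 g has_real_derivative 2 * frac_int 2 g x) (at x)"
    and D1: "(frac_int 2 g has_real_derivative frac_int 1 g x) (at x)"
    if "x \<in> {0<..<1}" for x
    using D[of 3 x] D[of 2 x] D[of 1 x] that by simp_all
  show ?thesis
  proof (rule has_fourth_derivativeI[where S="{0<..<1}"])
    show "((\<lambda>x. c * frac_int 4 g x + p * x ^ 2 + q * x ^ 3) has_real_derivative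
        3 * c * frac_int 3 g x + 2 * p * x + 3 * q * x ^ 2) (at x)" if "x \<in> {0<..<1}" for x
      by (rule derivative_eq_intros D3 that refl)+ simp
    show "((\<lambda>x. 3 * c * frac_int 3 g x + 2 * p * x + 3 * q * x ^ 2) has_real_derivative
        6 * c * frac_int 2 g x + 2 * p + 6 * q * x) (at x)" if "x \<in> {0<..<1}" for x
      by (rule derivative_eq_intros D2 that refl)+ simp
    show "((\<lambda>x. 6 * c * frac_int 2 g x + 2 * p + 6 * q * x) has_real_derivative
        6 * c * frac_int 1 g x + 6 * q) (at x)" if "x \<in> {0<..<1}" for x
      by (rule derivative_eq_intros D1 that refl)+ simp
    show "((\<lambda>x. 6 * c * frac_int 1 g x + 6 * q) has_real_derivative 6 * c * g t) (at t)"
      by (rule derivative_eq_intros frac_int_1_has_derivative t cont refl)+ simp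
  qed (use t f in auto)
qed

text \<open>Convolving with the kernel of order \<open>4 - \<alpha>\<close> turns the fractional
  integral of order \<open>\<alpha>\<close> into one of order 4 and the two powers into a quadratic
  and a cubic term. For \<open>\<alpha> = 4\<close> this shape is already there.\<close>

lemma green_op_has_RL_derivative:
  assumes \<alpha>: "3 < \<alpha>" "\<alpha> \<le> 4"
    and cont: "\<And>x. x \<in> {0<..<1} \<Longrightarrow> isCont g x" and t: "t \<in> {0<..<1}"
  shows "has_RL_derivative \<alpha> (green_op \<alpha> g) (g t) t"
proof (cases "\<alpha> = 4")
  case True
  have G4: "Gamma (4::real) = 6"
    using Gamma_fact[of 3, where 'a=real] by (simp add: fact_numeral)
  have "has_fourth_derivative (green_op \<alpha> g) (6 * (1 / 6) * g t) t"
  proof (rule frac_int_4_fourth_derivative[OF cont t])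
    fix x :: real assume "x \<in> {0<..<1}"
    then show "green_op \<alpha> g x = (1 / 6) * frac_int 4 g x
        + (green_coeff2 4 g / 6) * x ^ 2 + (green_coeff1 4 g / 6) * x ^ 3"
      by (simp add: True green_op_eq G4 add_divide_distrib)
  qed
  then show ?thesis using True by (simp add: has_RL_derivative_def)
next
  case False
  then have a4: "4 - \<alpha> > 0" using \<alpha> by simp
  let ?B = "Beta (4 - \<alpha>) \<alpha> / Gamma \<alpha>"
  have G: "Gamma \<alpha> > 0" "Gamma (4 - \<alpha>) > 0" using \<alpha> a4 by (auto intro!: Gamma_real_pos)
  \<comment> \<open>As \<open>Gamma 4 = 6\<close>, the factor \<open>6 * ?B\<close> is
    \<open>Gamma (4 - \<alpha>)\<close> and cancels the normalisation in
    \<open>has_RL_derivative\<close>.\<close>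
  have B: "?B = Gamma (4 - \<alpha>) / 6"
    using G Gamma_fact[of 3, where 'a=real] by (simp add: Beta_def fact_numeral)
  have "has_fourth_derivative (\<lambda>x. integral {0..x} (\<lambda>s. (x - s) powr (3 - \<alpha>) * green_op \<alpha> g s))
      (6 * ?B * g t) t"
  proof (rule frac_int_4_fourth_derivative[OF cont t])
    fix x :: real assume x: "x \<in> {0<..<1}"
    have 1: "((\<lambda>s. (x - s) powr (3 - \<alpha>) * frac_int \<alpha> g s) has_integral
        Beta (4 - \<alpha>) \<alpha> * frac_int 4 g x) {0..x}"
      using frac_int_semigroup[of "4 - \<alpha>" \<alpha> x] a4 \<alpha> x by simp
    have 2: "((\<lambda>s. (x - s) powr (3 - \<alpha>) * s powr (\<alpha> - 2)) has_integral
        Beta (4 - \<alpha>) (\<alpha> - 1) * x ^ 2) {0..x}"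
      using has_integral_powr_convolution[of "4 - \<alpha>" "\<alpha> - 1" x] a4 \<alpha> x by simp
    have 3: "((\<lambda>s. (x - s) powr (3 - \<alpha>) * s powr (\<alpha> - 1)) has_integral
        Beta (4 - \<alpha>) \<alpha> * x ^ 3) {0..x}"
      using has_integral_powr_convolution[of "4 - \<alpha>" \<alpha> x] a4 \<alpha> x by simp
    have "((\<lambda>s. (x - s) powr (3 - \<alpha>) * green_op \<alpha> g s) has_integral
        (Beta (4 - \<alpha>) \<alpha> * frac_int 4 g x
         + green_coeff2 \<alpha> g * (Beta (4 - \<alpha>) (\<alpha> - 1) * x ^ 2)
         + green_coeff1 \<alpha> g * (Beta (4 - \<alpha>) \<alpha> * x ^ 3)) / Gamma \<alpha>) {0..x}"
      by (rule has_integral_eq[OF _ has_integral_divide[OF has_integral_add[OF has_integral_add[OF 1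
        has_integral_mult_right[OF 2, of "green_coeff2 \<alpha> g"]]
        has_integral_mult_right[OF 3, of "green_coeff1 \<alpha> g"]], of "Gamma \<alpha>"]])
        (use x \<alpha> G in \<open>simp add: green_op_eq field_simps\<close>)
    from integral_unique[OF this]
    show "integral {0..x} (\<lambda>s. (x - s) powr (3 - \<alpha>) * green_op \<alpha> g s) =
        ?B * frac_int 4 g x
        + (green_coeff2 \<alpha> g * Beta (4 - \<alpha>) (\<alpha> - 1) / Gamma \<alpha>) * x ^ 2
        + (green_coeff1 \<alpha> g * Beta (4 - \<alpha>) \<alpha> / Gamma \<alpha>) * x ^ 3"
      by (simp add: add_divide_distrib)
  qed
  then show ?thesis using False G unfolding B has_RL_derivative_def by auto
qed

text \<open>Reduces all quantities at \<open>t = 1\<close> to two moments, the integrals of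
  \<open>(1 - s) powr (\<alpha> - 2) * g s\<close> without and with a further factor
  \<open>s\<close>.\<close>

lemma frac_int_at_1:
  assumes "\<alpha> \<ge> 3"
  shows "frac_int (\<alpha> - 1) g 1 = integral {0..1} (\<lambda>s. (1 - s) powr (\<alpha> - 2) * g s)"
    and "frac_int \<alpha> g 1 = integral {0..1} (\<lambda>s. (1 - s) powr (\<alpha> - 2) * g s)
           - integral {0..1} (\<lambda>s. (1 - s) powr (\<alpha> - 2) * s * g s)"
    and "green_coeff1 \<alpha> g = - integral {0..1} (\<lambda>s. (1 - s) powr (\<alpha> - 2) * g s)
           - (\<alpha> - 2) * integral {0..1} (\<lambda>s. (1 - s) powr (\<alpha> - 2) * s * g s)"
proof -
  note int = integrable_at_1[OF assms]
  show "frac_int (\<alpha> - 1) g 1 = integral {0..1} (\<lambda>s. (1 - s) powr (\<alpha> - 2) * g s)"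
    unfolding frac_int_def by simp
  have "frac_int \<alpha> g 1 = integral {0..1} (\<lambda>s. (1 - s) powr (\<alpha> - 2) * g s - (1 - s) powr (\<alpha> - 2) * s * g s)"
    unfolding frac_int_def
  proof (rule integral_cong)
    fix s :: real assume "s \<in> {0..1}"
    then have "(1 - s) powr (\<alpha> - 1) = (1 - s) * (1 - s) powr (\<alpha> - 2)"
      using powr_mult_base[of "1 - s" "\<alpha> - 2"] by simp
    then show "(1 - s) powr (\<alpha> - 1) * g s = (1 - s) powr (\<alpha> - 2) * g s - (1 - s) powr (\<alpha> - 2) * s * g s"
      by (simp only:) (simp add: algebra_simps)
  qed
  also have "\<dots> = integral {0..1} (\<lambda>s. (1 - s) powr (\<alpha> - 2) * g s)
      - integral {0..1} (\<lambda>s. (1 - s) powr (\<alpha> - 2) * s * g s)"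
    by (rule integral_diff) (fact int)+
  finally show "frac_int \<alpha> g 1 = \<dots>" .
  have "integral {0..1} (\<lambda>s. (1 - s) powr (\<alpha> - 2) * (1 + (\<alpha> - 2) * s) * g s) =
      integral {0..1} (\<lambda>s. (1 - s) powr (\<alpha> - 2) * g s + (\<alpha> - 2) * ((1 - s) powr (\<alpha> - 2) * s * g s))"
    by (rule integral_cong) (simp add: algebra_simps)
  also have "\<dots> = integral {0..1} (\<lambda>s. (1 - s) powr (\<alpha> - 2) * g s)
      + (\<alpha> - 2) * integral {0..1} (\<lambda>s. (1 - s) powr (\<alpha> - 2) * s * g s)"
    by (subst integral_add) (use int in \<open>auto intro!: integrable_on_mult_right\<close>)
  finally show "green_coeff1 \<alpha> g = - integral {0..1} (\<lambda>s. (1 - s) powr (\<alpha> - 2) * g s)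
           - (\<alpha> - 2) * integral {0..1} (\<lambda>s. (1 - s) powr (\<alpha> - 2) * s * g s)"
    unfolding green_coeff1_def by simp
qed

text \<open>At 0 all terms vanish together with their derivatives, as
  \<open>\<alpha> - 2 > 1\<close>. At 1, writing A and B for the two moments, the terms are A - B,
  (\<alpha> - 1) B and - A - (\<alpha> - 2) B: they sum to 0, and so do their derivatives.\<close>

lemma green_op_boundary:
  assumes \<alpha>: "\<alpha> > 3"
  shows "green_op \<alpha> g 0 = 0" "green_op \<alpha> g 1 = 0"
    and "(green_op \<alpha> g has_real_derivative 0) (at_right 0)"
    and "(green_op \<alpha> g has_real_derivative 0) (at_left 1)"
proof -
  note at1 = frac_int_at_1[of \<alpha>] green_coeff2_def[of \<alpha> g]
  show "green_op \<alpha> g 0 = 0"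
    using \<alpha> by (simp add: green_op_eq frac_int_def)
  show "green_op \<alpha> g 1 = 0"
    using \<alpha> by (simp add: green_op_eq at1 algebra_simps)
  let ?F = "\<lambda>t. (frac_int \<alpha> g t + green_coeff2 \<alpha> g * t powr (\<alpha> - 2)
    + green_coeff1 \<alpha> g * t powr (\<alpha> - 1)) / Gamma \<alpha>"
  have tr: "(green_op \<alpha> g has_real_derivative d) (at t within {0..1})"
    if "(?F has_real_derivative d) (at t within {0..1})" "t \<in> {0..1}" for d t
    by (rule has_field_derivative_transform_within[OF that(1) zero_less_one that(2)])
      (use \<alpha> in \<open>simp add: green_op_eq\<close>)
  have D: "(frac_int \<alpha> g has_real_derivative (\<alpha> - 1) * frac_int (\<alpha> - 1) g t) (at t within {0..1})"
    if "t \<in> {0..1}" for t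
    using frac_int_has_derivative[of "\<alpha> - 1" t] that \<alpha> by simp
  have "(?F has_real_derivative ((\<alpha> - 1) * frac_int (\<alpha> - 1) g 0 + green_coeff2 \<alpha> g * 0
      + green_coeff1 \<alpha> g * 0) / Gamma \<alpha>) (at 0 within {0..1})"
    by (intro DERIV_cdivide DERIV_add DERIV_cmult D powr_has_derivative_0) (use \<alpha> in auto)
  then have "(green_op \<alpha> g has_real_derivative 0) (at 0 within {0..1})"
    by (intro tr) (simp_all add: frac_int_def)
  then show "(green_op \<alpha> g has_real_derivative 0) (at_right 0)"
    by (simp add: at_within_Icc_at_right)
  have P: "((\<lambda>t. t powr c) has_real_derivative c) (at 1 within {0..1})" for c :: real
    using has_real_derivative_powr[of 1 c] by (simp add: has_field_derivative_at_within)
  have "(?F has_real_derivative ((\<alpha> - 1) * frac_int (\<alpha> - 1) g 1 + green_coeff2 \<alpha> g * (\<alpha> - 2)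
      + green_coeff1 \<alpha> g * (\<alpha> - 1)) / Gamma \<alpha>) (at 1 within {0..1})"
    by (intro DERIV_cdivide DERIV_add DERIV_cmult D P) auto
  moreover have "(\<alpha> - 1) * frac_int (\<alpha> - 1) g 1 + green_coeff2 \<alpha> g * (\<alpha> - 2)
      + green_coeff1 \<alpha> g * (\<alpha> - 1) = 0"
    using \<alpha> by (simp add: at1 algebra_simps)
  ultimately have "(green_op \<alpha> g has_real_derivative 0) (at 1 within {0..1})"
    by (intro tr) simp_all
  then show "(green_op \<alpha> g has_real_derivative 0) (at_left 1)"
    by (simp add: at_within_Icc_at_left)
qed

end

section \<open>Uniqueness for the linear boundary value problem\<close>

lemma same_derivative_diff_const:
  fixes F P p :: "real \<Rightarrow> real"
  assumes "\<And>x. x \<in> {0<..<1} \<Longrightarrow> (F has_real_derivative p x) (at x)"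
    and "\<And>x. x \<in> {0<..<1} \<Longrightarrow> (P has_real_derivative p x) (at x)"
  shows "\<exists>c. \<forall>x\<in>{0<..<1}. F x = P x + c"
proof -
  have "((\<lambda>x. F x - P x) has_real_derivative 0) (at x within {0<..<1})" if "x \<in> {0<..<1}" for x
    using DERIV_diff[OF assms[OF that]] by (simp add: has_field_derivative_at_within)
  then obtain c where "\<forall>x\<in>{0<..<1}. F x - P x = c"
    using has_field_derivative_zero_constant[of "{0<..<1}" "\<lambda>x. F x - P x"] by auto
  then show ?thesis by (intro exI[of _ c]) (auto simp: algebra_simps)
qed

text \<open>Integrates from the third derivative downwards; each level contributes one constant of
  integration, and the constants found earlier are carried along as explicit primitives.\<close>

lemma same_fourth_derivative_diff_cubic:
  assumes F: "\<And>x. x \<in> {0<..<1} \<Longrightarrow> has_fourth_derivative F (d x) x"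
    and G: "\<And>x. x \<in> {0<..<1} \<Longrightarrow> has_fourth_derivative G (d x) x"
  shows "\<exists>c0 c1 c2 c3. \<forall>x\<in>{0<..<1}. F x - G x = c0 + c1 * x + c2 * x ^ 2 + c3 * x ^ 3"
proof -
  note F' = has_fourth_derivativeD[OF F] and G' = has_fourth_derivativeD[OF G]
  obtain a where a: "\<And>x. x \<in> {0<..<1} \<Longrightarrow> deriv (deriv (deriv F)) x = deriv (deriv (deriv G)) x + a"
    using same_derivative_diff_const[OF F'(4) G'(4)] by auto
  have "((\<lambda>x. deriv (deriv G) x + a * x) has_real_derivative deriv (deriv (deriv F)) x) (at x)"
    if "x \<in> {0<..<1}" for x
    by (rule derivative_eq_intros G'(3) that refl)+ (use a[OF that] in simp)
  from same_derivative_diff_const[OF F'(3) this]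
  obtain b where b: "\<And>x. x \<in> {0<..<1} \<Longrightarrow> deriv (deriv F) x = deriv (deriv G) x + a * x + b"
    by auto
  have "((\<lambda>x. deriv G x + a / 2 * x ^ 2 + b * x) has_real_derivative deriv (deriv F) x) (at x)"
    if "x \<in> {0<..<1}" for x
    by (rule derivative_eq_intros G'(2) that refl)+ (use b[OF that] in simp)
  from same_derivative_diff_const[OF F'(2) this]
  obtain c where c: "\<And>x. x \<in> {0<..<1} \<Longrightarrow> deriv F x = deriv G x + a / 2 * x ^ 2 + b * x + c"
    by auto
  have "((\<lambda>x. G x + a / 6 * x ^ 3 + b / 2 * x ^ 2 + c * x) has_real_derivative deriv F x) (at x)"
    if "x \<in> {0<..<1}" for x
    by (rule derivative_eq_intros G'(1) that refl)+ (use c[OF that] in simp)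
  from same_derivative_diff_const[OF F'(1) this]
  obtain e where "\<And>x. x \<in> {0<..<1} \<Longrightarrow> F x = G x + a / 6 * x ^ 3 + b / 2 * x ^ 2 + c * x + e"
    by auto
  then show ?thesis
    by (intro exI[of _ e] exI[of _ c] exI[of _ "b / 2"] exI[of _ "a / 6"]) simp
qed

lemma continuous_zero_on_closed_interval:
  fixes \<phi> :: "real \<Rightarrow> real"
  assumes "continuous_on {0..1} \<phi>" "\<And>x. x \<in> {0<..<1} \<Longrightarrow> \<phi> x = 0" "x \<in> {0..1}"
  shows "\<phi> x = 0"
  using continuous_constant_on_closure[of "{0<..<1}" \<phi> 0 x] assms
  by (simp add: closure_greaterThanLessThan)

section \<open>Injectivity of fractional integrals of order below one\<close>

lemma has_integral_kernel:
  fixes a x :: real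
  assumes "a > 0" "x \<ge> 0"
  shows "((\<lambda>s. (x - s) powr (a - 1)) has_integral Beta a 1 * x powr a) {0..x}"
proof -
  have "((\<lambda>s. (x - s) powr (a - 1) * s powr (1 - 1)) has_integral Beta a 1 * x powr (a + 1 - 1)) {0..x}"
    using assms by (intro has_integral_powr_convolution) auto
  \<comment> \<open>The factor \<open>s powr 0\<close> is 1 except at \<open>s = 0\<close>, where it
    is 0.\<close>
  then have "((\<lambda>s. (x - s) powr (a - 1)) has_integral Beta a 1 * x powr (a + 1 - 1)) {0..x}"
    by (rule has_integral_spike_finite[where S="{0}", rotated -1]) auto
  then show ?thesis by simp
qed

text \<open>For \<open>a < 1\<close> the kernel is unbounded near \<open>s = x\<close>, so the roles
  are exchanged: the kernel is the integrable weight, and the continuous \<open>\<phi>\<close> is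
  the bounded factor.\<close>

lemma frac_int_integrable:
  fixes \<phi> :: "real \<Rightarrow> real"
  assumes a: "a > 0" and cont: "continuous_on {0..1} \<phi>" and x: "x \<in> {0..1}"
  shows "(\<lambda>s. (x - s) powr (a - 1) * \<phi> s) integrable_on {0..x}"
proof -
  have "compact (\<phi> ` {0..1})" by (intro compact_continuous_image cont) simp
  then obtain B where B: "\<And>s. s \<in> {0..1} \<Longrightarrow> \<bar>\<phi> s\<bar> \<le> B"
    using compact_imp_bounded bounded_iff by (metis imageI real_norm_def)
  have "(\<lambda>s. (indicator {0..1} s *\<^sub>R \<phi> s) * (x - s) powr (a - 1)) integrable_on {0..x}"
  proof (rule integrable_mult_bounded_borel)
    show "(\<lambda>s. (x - s) powr (a - 1)) integrable_on {0..x}"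
      using has_integral_kernel[of a x] a x by auto
    show "(\<lambda>s. indicator {0..1} s *\<^sub>R \<phi> s) \<in> borel_measurable borel"
      by (intro borel_measurable_continuous_on_indicator cont) simp
    show "\<bar>indicator {0..1} s *\<^sub>R \<phi> s\<bar> \<le> B" if "s \<in> {0..x}" for s
      using B[of s] x that by (simp add: abs_mult)
  qed simp
  then show ?thesis
    by (rule integrable_eq) (use x in \<open>auto simp: mult.commute\<close>)
qed

text \<open>Applying the fractional integral of order \<open>1 - a\<close> turns the one of order \<open>a\<close> into the
  ordinary integral; \<open>\<phi>\<close> is split into positive and negative part because the
  semigroup law was obtained from Tonelli's theorem.\<close>

lemma frac_int_eq_0_imp_eq_0:
  fixes \<phi> :: "real \<Rightarrow> real"
  assumes a: "0 < a" "a < 1" and cont: "continuous_on {0..1} \<phi>"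
    and zero: "\<And>x. x \<in> {0<..<1} \<Longrightarrow> frac_int a \<phi> x = 0"
    and x: "x \<in> {0..1}"
  shows "\<phi> x = 0"
proof -
  define pp where "pp s = indicator {0..1} s *\<^sub>R max (\<phi> s) 0" for s :: real
  define nn where "nn s = indicator {0..1} s *\<^sub>R max (- \<phi> s) 0" for s :: real
  have contpn: "continuous_on {0..1} (\<lambda>s. max (\<phi> s) 0)" "continuous_on {0..1} (\<lambda>s. max (- \<phi> s) 0)"
    by (intro continuous_intros cont)+
  have m: "pp \<in> borel_measurable borel" "nn \<in> borel_measurable borel"
    unfolding pp_def nn_def
    by (intro borel_measurable_continuous_on_indicator contpn; simp)+
  have nonneg: "pp s \<ge> 0" "nn s \<ge> 0" for s by (simp_all add: pp_def nn_def)
  have cont': "continuous_on {0..1} pp" "continuous_on {0..1} nn"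
    by (rule continuous_on_eq[OF contpn(1)], simp add: pp_def,
        rule continuous_on_eq[OF contpn(2)], simp add: nn_def)
  have diff: "\<phi> s = pp s - nn s" if "s \<in> {0..1}" for s
    using that by (auto simp: pp_def nn_def)
  note int = frac_int_integrable[OF _ cont'(1)] frac_int_integrable[OF _ cont'(2)]
  have fdiff: "frac_int b \<phi> x = frac_int b pp x - frac_int b nn x" if "b > 0" "x \<in> {0..1}" for b x
  proof -
    have "frac_int b \<phi> x = integral {0..x} (\<lambda>s. (x - s) powr (b - 1) * pp s - (x - s) powr (b - 1) * nn s)"
      unfolding frac_int_def by (rule integral_cong) (use that in \<open>simp add: diff algebra_simps\<close>)
    also have "\<dots> = frac_int b pp x - frac_int b nn x"
      unfolding frac_int_def by (rule integral_diff) (use int that in auto)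
    finally show ?thesis .
  qed
  have int0: "integral {0..X} \<phi> = 0" if X: "X \<in> {0<..<1}" for X
  proof -
    have p: "((\<lambda>x. (X - x) powr (1 - a - 1) * frac_int a pp x) has_integral
           Beta (1 - a) a * frac_int (1 - a + a) pp X) {0..X}"
      by (intro frac_int_frac_int m nonneg int) (use a X in auto)
    have n: "((\<lambda>x. (X - x) powr (1 - a - 1) * frac_int a nn x) has_integral
           Beta (1 - a) a * frac_int (1 - a + a) nn X) {0..X}"
      by (intro frac_int_frac_int m nonneg int) (use a X in auto)
    have "frac_int a pp x = frac_int a nn x" if "x \<in> {0..X}" for x
    proof (cases "x = 0")
      case True
      then show ?thesis by (simp add: frac_int_def)
    next
      case False
      then show ?thesis using fdiff[of a x] zero[of x] that X a by auto
    qed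
    \<comment> \<open>The two instances of the semigroup law now integrate the same function, so
      their values agree, and the nonzero Beta factor cancels.\<close>
    then have "((\<lambda>x. (X - x) powr (1 - a - 1) * frac_int a nn x) has_integral
           Beta (1 - a) a * frac_int (1 - a + a) pp X) {0..X}"
      by (intro has_integral_eq[OF _ p]) simp
    from has_integral_unique[OF this n]
    have "Beta (1 - a) a * frac_int 1 pp X = Beta (1 - a) a * frac_int 1 nn X" by simp
    moreover have "Gamma a \<noteq> 0" "Gamma (1 - a) \<noteq> 0"
      using Gamma_real_pos[of a] Gamma_real_pos[of "1 - a"] a by linarith+
    ultimately have "frac_int 1 \<phi> X = 0" using fdiff[of 1 X] X by (simp add: Beta_def)
    moreover have "frac_int 1 \<phi> X = integral {0..X} \<phi>"
      unfolding frac_int_def by (rule integral_spike[where S="{X}"]) auto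
    ultimately show ?thesis by simp
  qed
  have "\<phi> y = 0" if y: "y \<in> {0<..<1}" for y
  proof -
    have "((\<lambda>x. integral {0..x} \<phi>) has_real_derivative \<phi> y) (at y)"
      using integral_has_real_derivative[OF cont, of y] y by (simp add: at_within_Icc_at)
    moreover have "((\<lambda>x. integral {0..x} \<phi>) has_real_derivative 0) (at y)"
      by (rule has_field_derivative_transform_within_open[OF DERIV_const[of 0] open_greaterThanLessThan y])
        (simp add: int0)
    ultimately show ?thesis by (rule DERIV_unique)
  qed
  from continuous_zero_on_closed_interval[OF cont this x] show ?thesis .
qed

text \<open>The functions themselves (\<open>\<alpha> = 4\<close>) or their fractional integrals of
  order \<open>4 - \<alpha>\<close> differ by a cubic polynomial without constant term. In the
  fractional case a combination of powers with the same fractional integral is written down, and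
  injectivity identifies it with the difference.\<close>

lemma has_RL_derivative_eq_imp_diff_powers:
  assumes \<alpha>: "3 < \<alpha>" "\<alpha> \<le> 4"
    and contu: "continuous_on {0..1} u" and contv: "continuous_on {0..1} v"
    and u: "\<And>x. x \<in> {0<..<1} \<Longrightarrow> has_RL_derivative \<alpha> u (d x) x"
    and v: "\<And>x. x \<in> {0<..<1} \<Longrightarrow> has_RL_derivative \<alpha> v (d x) x"
    and 0: "u 0 = v 0"
  shows "\<exists>c1 c2 c3. \<forall>x\<in>{0..1}. u x - v x =
    c1 * x powr (\<alpha> - 3) + c2 * x powr (\<alpha> - 2) + c3 * x powr (\<alpha> - 1)"
proof (cases "\<alpha> = 4")
  case True
  obtain c0 c1 c2 c3 where
    c: "\<And>x. x \<in> {0<..<1} \<Longrightarrow> u x - v x = c0 + c1 * x + c2 * x ^ 2 + c3 * x ^ 3"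
    using same_fourth_derivative_diff_cubic[of u d v] u v True
    unfolding has_RL_derivative_def by auto
  have *: "u x - v x - (c0 + c1 * x + c2 * x ^ 2 + c3 * x ^ 3) = 0" if "x \<in> {0..1}" for x
    by (rule continuous_zero_on_closed_interval[OF _ _ that])
      (use c in \<open>auto intro!: continuous_intros contu contv\<close>)
  from *[of 0] 0 have "c0 = 0" by simp
  then have "u x - v x = c1 * x powr (\<alpha> - 3) + c2 * x powr (\<alpha> - 2) + c3 * x powr (\<alpha> - 1)"
    if "x \<in> {0..1}" for x
    using *[OF that] that by (cases "x = 0") (auto simp: True)
  then show ?thesis by blast
next
  case False
  define a where "a = 4 - \<alpha>"
  have a: "0 < a" "a < 1" using \<alpha> False by (auto simp: a_def)
  have Ga: "Gamma a \<noteq> 0" using Gamma_real_pos[of a] a by linarith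
  let ?w = "\<lambda>x. u x - v x"
  have contw: "continuous_on {0..1} ?w" by (intro continuous_intros contu contv)
  have four: "has_fourth_derivative (frac_int a w) (Gamma a * d x) x"
    if "has_RL_derivative \<alpha> w (d x) x" for w x
    using that False Ga unfolding has_RL_derivative_def frac_int_def a_def
    by (auto simp: field_simps)
  obtain c0 c1 c2 c3 where c: "\<And>x. x \<in> {0<..<1} \<Longrightarrow>
      frac_int a u x - frac_int a v x = c0 + c1 * x + c2 * x ^ 2 + c3 * x ^ 3"
    using same_fourth_derivative_diff_cubic[OF four[OF u] four[OF v]] by auto
  have fw: "frac_int a ?w x = c0 + c1 * x + c2 * x ^ 2 + c3 * x ^ 3" if x: "x \<in> {0<..<1}" for x
  proof -
    have "frac_int a ?w x = integral {0..x} (\<lambda>s. (x - s) powr (a - 1) * u s - (x - s) powr (a - 1) * v s)"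
      unfolding frac_int_def by (simp add: algebra_simps)
    also have "\<dots> = frac_int a u x - frac_int a v x"
      unfolding frac_int_def
      by (rule integral_diff) (use frac_int_integrable[OF a(1) contu] frac_int_integrable[OF a(1) contv] x in auto)
    finally show ?thesis using c[OF x] by simp
  qed
  have "compact (?w ` {0..1})" by (intro compact_continuous_image contw) simp
  then obtain M where M: "\<And>s. s \<in> {0..1} \<Longrightarrow> \<bar>?w s\<bar> \<le> M"
    using compact_imp_bounded bounded_iff by (metis (no_types, lifting) imageI real_norm_def)
  have bound: "\<bar>frac_int a ?w x\<bar> \<le> M * Beta a 1 * x powr a" if x: "x \<in> {0<..<1}" for x
  proof -
    have k: "((\<lambda>s. M * (x - s) powr (a - 1)) has_integral M * (Beta a 1 * x powr a)) {0..x}"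
      using has_integral_kernel[of a x] a x by (intro has_integral_mult_right) auto
    have "norm (integral {0..x} (\<lambda>s. (x - s) powr (a - 1) * ?w s))
        \<le> integral {0..x} (\<lambda>s. M * (x - s) powr (a - 1))"
    proof (rule integral_norm_bound_integral)
      show "(\<lambda>s. (x - s) powr (a - 1) * ?w s) integrable_on {0..x}"
        by (rule frac_int_integrable[OF a(1) contw]) (use x in auto)
      show "(\<lambda>s. M * (x - s) powr (a - 1)) integrable_on {0..x}" using k by blast
      fix s assume "s \<in> {0..x}"
      then show "norm ((x - s) powr (a - 1) * ?w s) \<le> M * (x - s) powr (a - 1)"
        using M[of s] x by (simp add: abs_mult mult.commute mult_right_mono)
    qed
    then show ?thesis
      unfolding integral_unique[OF k] by (simp only: frac_int_def mult.assoc real_norm_def)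
  qed
  have ev: "\<forall>\<^sub>F x in at_right 0. x \<in> {0<..<1::real}"
    using eventually_at_right_real[of 0 1] by auto
  \<comment> \<open>By \<open>bound\<close> the fractional integral of the difference is of order
    \<open>x powr a\<close>, hence tends to 0 at 0, while the polynomial tends to
    \<open>c0\<close>.\<close>
  have "c0 = 0"
  proof -
    have "continuous_on {0..1} (\<lambda>x. M * Beta a 1 * x powr a)"
      using a by (intro continuous_on_mult continuous_on_const continuous_on_powr_unit)
    then have "((\<lambda>x. M * Beta a 1 * x powr a) \<longlongrightarrow> M * Beta a 1 * 0 powr a) (at 0 within {0..1})"
      unfolding continuous_on_def by (rule bspec) simp
    then have "((\<lambda>x. M * Beta a 1 * x powr a) \<longlongrightarrow> 0) (at_right 0)"
      by (simp add: at_within_Icc_at_right)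
    then have "(frac_int a ?w \<longlongrightarrow> 0) (at_right 0)"
      by (rule Lim_null_comparison[rotated]) (use ev bound in \<open>auto elim!: eventually_mono\<close>)
    then have "((\<lambda>x. c0 + c1 * x + c2 * x ^ 2 + c3 * x ^ 3) \<longlongrightarrow> 0) (at_right 0)"
      by (rule Lim_transform_eventually) (use ev fw in \<open>auto elim!: eventually_mono\<close>)
    moreover have "((\<lambda>x. c0 + c1 * x + c2 * x ^ 2 + c3 * x ^ 3) \<longlongrightarrow>
        c0 + c1 * 0 + c2 * 0 ^ 2 + c3 * 0 ^ 3) (at_right 0)"
      by (intro tendsto_intros)
    ultimately show ?thesis
      using tendsto_unique[OF trivial_limit_at_right_real] by fastforce
  qed
  have B: "Beta a b \<noteq> 0" if "b > 0" for b
    using Gamma_real_pos[of a] Gamma_real_pos[of b] Gamma_real_pos[of "a + b"] a that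
    by (simp add: Beta_def less_imp_neq[symmetric] del: Gamma_real_pos)
  \<comment> \<open>Dividing by the Beta values makes the fractional integral of \<open>p\<close> of
    order \<open>a\<close> exactly \<open>c1 * x + c2 * x ^ 2 + c3 * x ^ 3\<close>.\<close>
  define p where "p x = c1 / Beta a (\<alpha> - 2) * x powr (\<alpha> - 3) + c2 / Beta a (\<alpha> - 1) * x powr (\<alpha> - 2)
      + c3 / Beta a \<alpha> * x powr (\<alpha> - 1)" for x
  have contp: "continuous_on {0..1} p"
    unfolding p_def using \<alpha>
    by (intro continuous_on_add continuous_on_mult continuous_on_const continuous_on_powr_unit) auto
  have fp: "frac_int a p x = c1 * x + c2 * x ^ 2 + c3 * x ^ 3" if x: "x \<in> {0<..<1}" for x
  proof -
    have 1: "((\<lambda>s. (x - s) powr (a - 1) * s powr (\<alpha> - 3)) has_integral Beta a (\<alpha> - 2) * x) {0..x}"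
      using has_integral_powr_convolution[of a "\<alpha> - 2" x] a \<alpha> x by (simp add: a_def)
    have 2: "((\<lambda>s. (x - s) powr (a - 1) * s powr (\<alpha> - 2)) has_integral Beta a (\<alpha> - 1) * x ^ 2) {0..x}"
      using has_integral_powr_convolution[of a "\<alpha> - 1" x] a \<alpha> x by (simp add: a_def)
    have 3: "((\<lambda>s. (x - s) powr (a - 1) * s powr (\<alpha> - 1)) has_integral Beta a \<alpha> * x ^ 3) {0..x}"
      using has_integral_powr_convolution[of a \<alpha> x] a \<alpha> x by (simp add: a_def)
    have "((\<lambda>s. (x - s) powr (a - 1) * p s) has_integral
        (c1 / Beta a (\<alpha> - 2) * (Beta a (\<alpha> - 2) * x) + c2 / Beta a (\<alpha> - 1) * (Beta a (\<alpha> - 1) * x ^ 2)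
         + c3 / Beta a \<alpha> * (Beta a \<alpha> * x ^ 3))) {0..x}"
      by (rule has_integral_eq[OF _ has_integral_add[OF has_integral_add[OF
        has_integral_mult_right[OF 1] has_integral_mult_right[OF 2]] has_integral_mult_right[OF 3]]])
        (simp add: p_def algebra_simps)
    from integral_unique[OF this] show ?thesis
      using \<alpha> B by (simp add: frac_int_def)
  qed
  have "?w x - p x = 0" if "x \<in> {0..1}" for x
  proof (rule frac_int_eq_0_imp_eq_0[OF a _ _ that])
    show "continuous_on {0..1} (\<lambda>x. ?w x - p x)" by (intro continuous_intros contw contp)
    fix x :: real assume x: "x \<in> {0<..<1}"
    have "frac_int a (\<lambda>x. ?w x - p x) x =
        integral {0..x} (\<lambda>s. (x - s) powr (a - 1) * ?w s - (x - s) powr (a - 1) * p s)"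
      unfolding frac_int_def by (simp add: algebra_simps)
    also have "\<dots> = frac_int a ?w x - frac_int a p x"
      unfolding frac_int_def
      by (rule integral_diff) (use frac_int_integrable[OF a(1) contw] frac_int_integrable[OF a(1) contp] x in auto)
    finally show "frac_int a (\<lambda>x. ?w x - p x) x = 0"
      using fw[OF x] fp[OF x] \<open>c0 = 0\<close> by simp
  qed
  then show ?thesis unfolding p_def by (metis (no_types, lifting) eq_iff_diff_eq_0)
qed

text \<open>The difference is a combination of three powers. The slope at 0 removes the lowest one,
  whose exponent is at most 1; the value and the slope at 1 give an invertible system for the other
  two coefficients.\<close>

lemma boundary_value_problem_unique:
  assumes \<alpha>: "3 < \<alpha>" "\<alpha> \<le> 4"
    and contu: "continuous_on {0..1} u" and contv: "continuous_on {0..1} v"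
    and u: "\<And>x. x \<in> {0<..<1} \<Longrightarrow> has_RL_derivative \<alpha> u (d x) x"
    and v: "\<And>x. x \<in> {0<..<1} \<Longrightarrow> has_RL_derivative \<alpha> v (d x) x"
    and 0: "u 0 = v 0" and 1: "u 1 = v 1"
    and u0: "(u has_real_derivative e) (at_right 0)" and v0: "(v has_real_derivative e) (at_right 0)"
    and u1: "(u has_real_derivative e') (at_left 1)" and v1: "(v has_real_derivative e') (at_left 1)"
    and x: "x \<in> {0..1}"
  shows "u x = v x"
proof -
  obtain c1 c2 c3 where c: "\<And>x. x \<in> {0..1} \<Longrightarrow> u x - v x =
      c1 * x powr (\<alpha> - 3) + c2 * x powr (\<alpha> - 2) + c3 * x powr (\<alpha> - 1)"
    using has_RL_derivative_eq_imp_diff_powers[OF \<alpha> contu contv u v 0] by auto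
  have ev: "\<forall>\<^sub>F x in at_right 0. x \<in> {0<..<1::real}"
    using eventually_at_right_real[of 0 1] by auto
  have "((\<lambda>x. (u x - v x) / x) \<longlongrightarrow> 0) (at_right 0)"
    using DERIV_diff[OF u0 v0] 0 by (simp add: has_field_derivative_iff)
  \<comment> \<open>The factor \<open>x powr (4 - \<alpha>)\<close> is at most 1 on the unit
    interval and turns the term with \<open>x powr (\<alpha> - 3)\<close> in the difference quotient
    into the constant \<open>c1\<close>.\<close>
  then have "((\<lambda>x. (u x - v x) / x * x powr (4 - \<alpha>)) \<longlongrightarrow> 0) (at_right 0)"
  proof (rule tendsto_0_le[where K=1])
    show "\<forall>\<^sub>F x in at_right 0. norm ((u x - v x) / x * x powr (4 - \<alpha>)) \<le> norm ((u x - v x) / x) * 1"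
    proof (rule eventually_mono[OF ev])
      fix x :: real assume "x \<in> {0<..<1}"
      then have "x powr (4 - \<alpha>) \<le> 1 powr (4 - \<alpha>)" using \<alpha> by (intro powr_mono2) auto
      then show "norm ((u x - v x) / x * x powr (4 - \<alpha>)) \<le> norm ((u x - v x) / x) * 1"
        unfolding norm_mult by (intro mult_left_mono) auto
    qed
  qed
  moreover have "\<forall>\<^sub>F x in at_right 0. (u x - v x) / x * x powr (4 - \<alpha>) = c1 + c2 * x + c3 * x ^ 2"
  proof (rule eventually_mono[OF ev])
    fix x :: real assume x: "x \<in> {0<..<1}"
    have p: "x powr (\<alpha> - 3) * x powr (4 - \<alpha>) = x" "x powr (\<alpha> - 2) * x powr (4 - \<alpha>) = x * x"
      "x powr (\<alpha> - 1) * x powr (4 - \<alpha>) = x * x ^ 2"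
      using x by (simp_all add: powr_add[symmetric] power2_eq_square[symmetric] power_Suc[symmetric]
          del: power_Suc)
    have "(u x - v x) * x powr (4 - \<alpha>) = c1 * (x powr (\<alpha> - 3) * x powr (4 - \<alpha>))
        + c2 * (x powr (\<alpha> - 2) * x powr (4 - \<alpha>)) + c3 * (x powr (\<alpha> - 1) * x powr (4 - \<alpha>))"
      using c[of x] x by (simp add: algebra_simps)
    also have "\<dots> = x * (c1 + c2 * x + c3 * x ^ 2)"
      unfolding p by (simp add: algebra_simps)
    finally show "(u x - v x) / x * x powr (4 - \<alpha>) = c1 + c2 * x + c3 * x ^ 2"
      using x by simp
  qed
  ultimately have "((\<lambda>x. c1 + c2 * x + c3 * x ^ 2) \<longlongrightarrow> 0) (at_right 0)"
    by (rule Lim_transform_eventually)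
  moreover have "((\<lambda>x. c1 + c2 * x + c3 * x ^ 2) \<longlongrightarrow> c1 + c2 * 0 + c3 * 0 ^ 2) (at_right 0)"
    by (intro tendsto_intros)
  ultimately have c1: "c1 = 0"
    using tendsto_unique[OF trivial_limit_at_right_real] by fastforce
  have c23: "c2 + c3 = 0" using c[of 1] 1 c1 by simp
  have P: "((\<lambda>t. t powr c) has_real_derivative c) (at 1 within {0..1})" for c :: real
    using has_real_derivative_powr[of 1 c] by (simp add: has_field_derivative_at_within)
  have "((\<lambda>x. c2 * x powr (\<alpha> - 2) + c3 * x powr (\<alpha> - 1)) has_real_derivative
      c2 * (\<alpha> - 2) + c3 * (\<alpha> - 1)) (at 1 within {0..1})"
    by (intro DERIV_add DERIV_cmult P)
  then have "((\<lambda>x. u x - v x) has_real_derivative c2 * (\<alpha> - 2) + c3 * (\<alpha> - 1)) (at 1 within {0..1})"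
    by (rule has_field_derivative_transform_within[OF _ zero_less_one]) (use c c1 in auto)
  then have "((\<lambda>x. u x - v x) has_real_derivative c2 * (\<alpha> - 2) + c3 * (\<alpha> - 1)) (at_left 1)"
    by (simp add: at_within_Icc_at_left)
  moreover have "((\<lambda>x. u x - v x) has_real_derivative 0) (at_left 1)"
    using DERIV_diff[OF u1 v1] by simp
  ultimately have "c2 * (\<alpha> - 2) + c3 * (\<alpha> - 1) = 0"
    unfolding has_field_derivative_iff by (rule tendsto_unique[OF trivial_limit_at_left_real])
  then have "(c2 + c3) * (\<alpha> - 2) + c3 = 0" by (simp add: algebra_simps)
  with c23 have "c3 = 0" "c2 = 0" by simp_all
  with c[OF x] c1 show ?thesis by simp
qed

section \<open>Contractions with gauge \<open>r / (1 + \<tau> \<surd>r)\<^sup>2\<close>\<close>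

definition contraction_gauge :: "real \<Rightarrow> real \<Rightarrow> real" where
  "contraction_gauge \<tau> r = r / (1 + \<tau> * sqrt r)\<^sup>2"

text \<open>The gauge is the square of \<open>sqrt r / (1 + \<tau> * sqrt r)\<close>, and
  \<open>y / (1 + \<tau> * y)\<close> increases for \<open>y \<ge> 0\<close>.\<close>

lemma contraction_gauge_mono:
  assumes "0 < \<tau>" "0 \<le> r" "r \<le> s"
  shows "contraction_gauge \<tau> r \<le> contraction_gauge \<tau> s"
proof -
  have *: "contraction_gauge \<tau> x = (sqrt x / (1 + \<tau> * sqrt x))\<^sup>2" if "x \<ge> 0" for x
    using that by (simp add: contraction_gauge_def power_divide)
  have pos: "1 + \<tau> * sqrt x > 0" if "x \<ge> 0" for x
    using that assms by (simp add: add_pos_nonneg)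
  have "sqrt r * (1 + \<tau> * sqrt s) \<le> sqrt s * (1 + \<tau> * sqrt r)"
    using assms by (simp add: algebra_simps)
  then have "sqrt r / (1 + \<tau> * sqrt r) \<le> sqrt s / (1 + \<tau> * sqrt s)"
    using assms pos[of r] pos[of s] by (simp add: frac_le_eq divide_le_eq pos_divide_le_eq pos_le_divide_eq)
  then have "(sqrt r / (1 + \<tau> * sqrt r))\<^sup>2 \<le> (sqrt s / (1 + \<tau> * sqrt s))\<^sup>2"
    using assms pos[of r] by (intro power_mono) auto
  then show ?thesis using assms by (simp add: *)
qed

lemma contraction_gauge_less:
  assumes "0 < \<tau>" "0 < r"
  shows "contraction_gauge \<tau> r < r"
proof -
  have *: "1 < (1 + \<tau> * sqrt r)\<^sup>2" using assms by (intro one_less_power) auto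
  have "r / (1 + \<tau> * sqrt r)\<^sup>2 < r / 1"
    by (rule divide_strict_left_mono[OF * assms(2)]) (use * in linarith)
  then show ?thesis by (simp add: contraction_gauge_def)
qed

lemma inverse_sqrt_contraction_gauge:
  assumes "0 < \<tau>" "0 < r"
  shows "inverse (sqrt (contraction_gauge \<tau> r)) = inverse (sqrt r) + \<tau>"
proof -
  have "1 + \<tau> * sqrt r > 0" using assms by (simp add: add_pos_nonneg)
  then have "sqrt (contraction_gauge \<tau> r) = sqrt r / (1 + \<tau> * sqrt r)" "1 + \<tau> * sqrt r \<noteq> 0"
    by (simp_all add: contraction_gauge_def real_sqrt_divide)
  then show ?thesis using assms by (simp only: inverse_eq_divide) (simp add: add_divide_distrib)
qed

text \<open>The gauge adds \<open>\<tau>\<close> to \<open>1 / sqrt r\<close>, so its \<open>n\<close>-th iterate is at most \<open>1 / (n \<tau>)\<^sup>2\<close>.\<close>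

lemma summable_contraction_gauge_iterates:
  assumes \<tau>: "0 < \<tau>" and r: "0 < r"
  shows "summable (\<lambda>n. (contraction_gauge \<tau> ^^ n) r)"
proof -
  let ?m = "\<lambda>n. (contraction_gauge \<tau> ^^ n) r"
  have pos: "?m n > 0" for n
  proof (induction n)
    case (Suc n)
    have "1 + \<tau> * sqrt (?m n) > 0" using Suc \<tau> by (simp add: add_pos_nonneg)
    then show ?case using Suc by (simp add: contraction_gauge_def[of _ "?m n"])
  qed (use r in simp)
  have inv: "inverse (sqrt (?m n)) \<ge> real n * \<tau>" for n
  proof (induction n)
    case (Suc n)
    then show ?case
      using inverse_sqrt_contraction_gauge[OF \<tau> pos[of n]] by (simp add: algebra_simps)
  qed (use r in simp)
  \<comment> \<open>The comparison starts at \<open>n = 1\<close>: for \<open>n = 0\<close> the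
    right-hand side is 0, as \<open>inverse 0 = 0\<close>.\<close>
  have le: "?m n \<le> inverse (\<tau>\<^sup>2) * inverse (real n ^ 2)" if "n \<ge> 1" for n
  proof -
    have "(real n * \<tau>)\<^sup>2 \<le> (inverse (sqrt (?m n)))\<^sup>2"
      using inv \<tau> by (intro power_mono) auto
    also have "\<dots> = inverse (?m n)" using pos[of n] by (simp add: power_inverse)
    finally have "inverse (inverse (?m n)) \<le> inverse ((real n * \<tau>)\<^sup>2)"
      using that \<tau> by (intro le_imp_inverse_le) auto
    then show ?thesis by (simp add: power_mult_distrib mult.commute)
  qed
  have "summable (\<lambda>n. inverse (\<tau>\<^sup>2) * inverse (real n ^ 2))"
    by (intro summable_mult inverse_power_summable) simp
  then show ?thesis
    by (rule summable_comparison_test'[where N=1]) (use le pos in \<open>auto simp: abs_of_pos\<close>)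
qed

text \<open>Quantifying over every uniform bound \<open>M\<close> replaces the supremum distance, so
  no function space has to be formed and only values on \<open>S\<close> matter.\<close>

locale gauge_contraction =
  fixes S :: "'a::topological_space set" and T :: "('a \<Rightarrow> real) \<Rightarrow> 'a \<Rightarrow> real" and \<tau> :: real
  assumes \<tau>: "\<tau> > 0" and compact: "compact S"
    and T_continuous: "\<And>u. continuous_on S u \<Longrightarrow> \<forall>t\<in>S. 0 \<le> u t \<Longrightarrow> continuous_on S (T u)"
    and T_nonneg: "\<And>u t. continuous_on S u \<Longrightarrow> \<forall>t\<in>S. 0 \<le> u t \<Longrightarrow> t \<in> S \<Longrightarrow> 0 \<le> T u t"
    and T_contraction: "\<And>u v M t. continuous_on S u \<Longrightarrow> \<forall>t\<in>S. 0 \<le> u t \<Longrightarrow>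
      continuous_on S v \<Longrightarrow> \<forall>t\<in>S. 0 \<le> v t \<Longrightarrow> 0 \<le> M \<Longrightarrow> \<forall>t\<in>S. \<bar>u t - v t\<bar> \<le> M \<Longrightarrow>
      t \<in> S \<Longrightarrow> \<bar>T u t - T v t\<bar> \<le> contraction_gauge \<tau> M"
begin

lemma fixed_point_unique:
  assumes u: "continuous_on S u" "\<forall>t\<in>S. 0 \<le> u t" "\<forall>t\<in>S. T u t = u t"
    and v: "continuous_on S v" "\<forall>t\<in>S. 0 \<le> v t" "\<forall>t\<in>S. T v t = v t"
    and t: "t \<in> S"
  shows "u t = v t"
proof -
  have "continuous_on S (\<lambda>t. \<bar>u t - v t\<bar>)" by (intro continuous_intros u v)
  then obtain t0 where t0: "t0 \<in> S" "\<forall>t\<in>S. \<bar>u t - v t\<bar> \<le> \<bar>u t0 - v t0\<bar>"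
    using continuous_attains_sup[OF compact] t by blast
  \<comment> \<open>The bound \<open>M\<close> is the largest deviation, attained at
    \<open>t0\<close>; a positive one would be strictly smaller than itself.\<close>
  have "\<bar>u t0 - v t0\<bar> \<le> contraction_gauge \<tau> \<bar>u t0 - v t0\<bar>"
    using T_contraction[OF u(1,2) v(1,2) _ t0(2) t0(1)] u(3) v(3) t0(1) by simp
  then have "\<not> \<bar>u t0 - v t0\<bar> > 0"
    using contraction_gauge_less[OF \<tau>, of "\<bar>u t0 - v t0\<bar>"] by linarith
  then show ?thesis using t0(2) t by fastforce
qed

lemma fixed_point_exists:
  "\<exists>u. continuous_on S u \<and> (\<forall>t\<in>S. 0 \<le> u t) \<and> (\<forall>t\<in>S. T u t = u t)"
proof -
  define U where "U n = (T ^^ n) (\<lambda>_. 0)" for n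
  have US: "U (Suc n) = T (U n)" for n by (simp add: U_def)
  have UC: "continuous_on S (U n) \<and> (\<forall>t\<in>S. 0 \<le> U n t)" for n
  proof (induction n)
    case 0
    then show ?case by (simp add: U_def)
  next
    case (Suc n)
    then show ?case using T_continuous T_nonneg US by auto
  qed
  then have Uc: "continuous_on S (U n)" and Un: "\<forall>t\<in>S. 0 \<le> U n t" for n by blast+
  have "compact (U 1 ` S)" by (intro compact_continuous_image Uc compact)
  \<comment> \<open>As \<open>U 0 = 0\<close>, this \<open>B\<close> bounds the first Picard step;
    it is taken positive because the summability of the gauge iterates is stated for positive
    starting values.\<close>
  then obtain B where B: "B > 0" "\<And>t. t \<in> S \<Longrightarrow> \<bar>U 1 t\<bar> \<le> B"
    using compact_imp_bounded bounded_pos by (metis (no_types, lifting) imageI real_norm_def)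
  let ?m = "\<lambda>n. (contraction_gauge \<tau> ^^ n) B"
  have m0: "?m n \<ge> 0" for n
    using B(1) by (induction n) (auto simp: contraction_gauge_def)
  have step: "\<forall>t\<in>S. \<bar>U (Suc n) t - U n t\<bar> \<le> ?m n" for n
  proof (induction n)
    case 0
    then show ?case using B by (simp add: U_def)
  next
    case (Suc n)
    then show ?case
      using T_contraction[OF Uc Un Uc Un m0, of "Suc n" n] by (simp add: US)
  qed
  define u where "u t = (\<Sum>n. U (Suc n) t - U n t)" for t
  have "uniform_limit S (\<lambda>n t. \<Sum>i<n. U (Suc i) t - U i t) u sequentially"
    unfolding u_def
    by (rule Weierstrass_m_test[OF _ summable_contraction_gauge_iterates[OF \<tau> B(1)]])
      (use step in auto)
  moreover have "(\<Sum>i<n. U (Suc i) t - U i t) = U n t" for n t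
    by (subst sum_lessThan_telescope) (simp add: U_def)
  ultimately have ul: "uniform_limit S U u sequentially" by simp
  have uc: "continuous_on S u"
    by (rule uniform_limit_theorem[OF _ ul]) (use Uc in auto)
  have lim: "(\<lambda>n. U n t) \<longlonglongrightarrow> u t" if "t \<in> S" for t
    using tendsto_uniform_limitI[OF ul that] .
  have un: "\<forall>t\<in>S. 0 \<le> u t"
    using Un LIMSEQ_le_const[OF lim] by blast
  have "T u t = u t" if t: "t \<in> S" for t
  proof -
    have "(\<lambda>n. U (Suc n) t) \<longlonglongrightarrow> T u t"
    proof (rule metric_LIMSEQ_I)
      fix e :: real assume "e > 0"
      then obtain n0 where n0: "\<And>n. n \<ge> n0 \<Longrightarrow> \<forall>t\<in>S. dist (U n t) (u t) < e"
        using ul unfolding uniform_limit_sequentially_iff by blast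
      \<comment> \<open>The gauge of \<open>e\<close> is below \<open>e\<close>, so the index that
        works for \<open>U n\<close> also works for its image under \<open>T\<close>.\<close>
      have "dist (U (Suc n) t) (T u t) < e" if "n \<ge> n0" for n
      proof -
        have "\<forall>t\<in>S. \<bar>U n t - u t\<bar> \<le> e"
          using n0[OF that] by (auto simp: dist_real_def less_imp_le)
        then have "\<bar>T (U n) t - T u t\<bar> \<le> contraction_gauge \<tau> e"
          using T_contraction[OF Uc Un uc un _ _ t] \<open>e > 0\<close> by auto
        then show ?thesis
          using contraction_gauge_less[OF \<tau> \<open>e > 0\<close>] by (simp add: US dist_real_def)
      qed
      then show "\<exists>no. \<forall>n\<ge>no. dist (U (Suc n) t) (T u t) < e" by blast
    qed
    moreover have "(\<lambda>n. U (Suc n) t) \<longlonglongrightarrow> u t"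
      using lim[OF t] by (rule LIMSEQ_Suc)
    ultimately show ?thesis by (rule LIMSEQ_unique)
  qed
  with uc un show ?thesis by blast
qed

end

section \<open>The nonlinear boundary value problem\<close>

text \<open>With \<open>k s = h s (u s)\<close> this is \<open>f s (u s)\<close> on the half-open
  interval from 0 to 1. The indicator makes it Borel on the whole line although \<open>k\<close> is
  controlled on \<open>{0..1}\<close> only.\<close>

definition singular_weight :: "real \<Rightarrow> (real \<Rightarrow> real) \<Rightarrow> real \<Rightarrow> real" where
  "singular_weight \<sigma> k s = s powr (- \<sigma>) * (indicator {0..1} s *\<^sub>R k s)"

lemma nonneg_integrable_powr:
  assumes "\<sigma> < 1"
  shows "nonneg_integrable (\<lambda>s. s powr (- \<sigma>))"
  by standard (use assms integrable_on_powr_from_0[of "- \<sigma>" 1] in auto)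

lemma nonneg_integrable_singular_weight:
  assumes \<sigma>: "\<sigma> < 1" and k: "continuous_on {0..1} k" "\<And>s. s \<in> {0..1} \<Longrightarrow> 0 \<le> k s"
  shows "nonneg_integrable (singular_weight \<sigma> k)"
proof
  interpret powr: nonneg_integrable "\<lambda>s. s powr (- \<sigma>)" by (rule nonneg_integrable_powr[OF \<sigma>])
  have m: "(\<lambda>s. indicator {0..1} s *\<^sub>R k s) \<in> borel_measurable borel"
    by (intro borel_measurable_continuous_on_indicator k) simp
  note m [measurable]
  show "singular_weight \<sigma> k \<in> borel_measurable borel"
    unfolding singular_weight_def by measurable
  show "0 \<le> singular_weight \<sigma> k s" for s
    using k(2) by (auto simp: singular_weight_def indicator_def)
  have "compact (k ` {0..1})" by (intro compact_continuous_image k) simp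
  then obtain B where B: "\<And>s. s \<in> {0..1} \<Longrightarrow> \<bar>k s\<bar> \<le> B"
    using compact_imp_bounded bounded_iff by (metis imageI real_norm_def)
  have "(\<lambda>s. (indicator {0..1} s *\<^sub>R k s) * s powr (- \<sigma>)) integrable_on {0..1}"
    by (rule powr.integrable_mult_bounded[OF m]) (use B in auto)
  then show "singular_weight \<sigma> k integrable_on {0..1}"
    by (rule integrable_eq) (simp add: singular_weight_def)
qed

lemma isCont_singular_weight:
  assumes k: "continuous_on {0..1} k" and x: "x \<in> {0<..<1}"
  shows "isCont (singular_weight \<sigma> k) x"
proof -
  have "continuous_on {0<..<1} (\<lambda>s. s powr (- \<sigma>) * k s)"
    by (intro continuous_on_mult continuous_on_powr continuous_on_id continuous_on_const
        continuous_on_subset[OF k]) auto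
  then have "continuous_on {0<..<1} (singular_weight \<sigma> k)"
    by (rule continuous_on_eq) (simp add: singular_weight_def)
  then show ?thesis using x by (simp add: continuous_on_eq_continuous_at)
qed

text \<open>\<open>GREATEST\<close> yields an upper bound once a maximum is known to be attained;
  continuity of the Green operator on the compact interval provides it.\<close>

lemma green_max_upper:
  assumes \<alpha>: "\<alpha> \<ge> 3" and \<sigma>: "\<sigma> < 1" and t: "t \<in> {0..1}"
  shows "green_op \<alpha> (\<lambda>s. s powr (- \<sigma>)) t \<le> green_max \<alpha> \<sigma>"
proof -
  interpret nonneg_integrable "\<lambda>s. s powr (- \<sigma>)" by (rule nonneg_integrable_powr[OF \<sigma>])
  let ?F = "green_op \<alpha> (\<lambda>s. s powr (- \<sigma>))"
  obtain t0 where t0: "t0 \<in> {0..1}" "\<forall>t\<in>{0..1}. ?F t \<le> ?F t0"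
    using continuous_attains_sup[OF _ _ continuous_green_op[OF \<alpha>]] by auto
  have "green_max \<alpha> \<sigma> = ?F t0"
    unfolding green_max_def green_op_def[symmetric]
    by (rule Greatest_equality) (use t0 in auto)
  then show ?thesis using t0(2) t by simp
qed

text \<open>The integrands differ by
  \<open>green \<alpha> t s * s powr (- \<sigma>) * (k s - l s)\<close>. Since the Green function is
  nonnegative, \<open>\<delta>\<close> comes out of the integral and the rest is at most
  \<open>green_max\<close>.\<close>

lemma green_op_singular_weight_diff:
  assumes \<alpha>: "\<alpha> \<ge> 3" and \<sigma>: "\<sigma> < 1" and t: "t \<in> {0..1}"
    and k: "continuous_on {0..1} k" "\<And>s. s \<in> {0..1} \<Longrightarrow> 0 \<le> k s"
    and l: "continuous_on {0..1} l" "\<And>s. s \<in> {0..1} \<Longrightarrow> 0 \<le> l s"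
    and \<delta>: "0 \<le> \<delta>" "\<And>s. s \<in> {0..1} \<Longrightarrow> \<bar>k s - l s\<bar> \<le> \<delta>"
  shows "\<bar>green_op \<alpha> (singular_weight \<sigma> k) t - green_op \<alpha> (singular_weight \<sigma> l) t\<bar>
    \<le> \<delta> * green_max \<alpha> \<sigma>"
proof -
  interpret powr: nonneg_integrable "\<lambda>s. s powr (- \<sigma>)" by (rule nonneg_integrable_powr[OF \<sigma>])
  interpret k: nonneg_integrable "singular_weight \<sigma> k"
    by (rule nonneg_integrable_singular_weight[OF \<sigma> k])
  interpret l: nonneg_integrable "singular_weight \<sigma> l"
    by (rule nonneg_integrable_singular_weight[OF \<sigma> l])
  note int = has_integral_integrable[OF k.green_has_integral[OF \<alpha> t]]
    has_integral_integrable[OF l.green_has_integral[OF \<alpha> t]]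
    has_integral_integrable[OF powr.green_has_integral[OF \<alpha> t]]
  have "\<bar>green_op \<alpha> (singular_weight \<sigma> k) t - green_op \<alpha> (singular_weight \<sigma> l) t\<bar> =
      norm (integral {0..1} (\<lambda>s. green \<alpha> t s * singular_weight \<sigma> k s - green \<alpha> t s * singular_weight \<sigma> l s))"
    unfolding green_op_def by (subst integral_diff) (use int in auto)
  also have "\<dots> \<le> integral {0..1} (\<lambda>s. \<delta> * (green \<alpha> t s * s powr (- \<sigma>)))"
  proof (rule integral_norm_bound_integral)
    fix s :: real assume s: "s \<in> {0..1}"
    have "green \<alpha> t s * singular_weight \<sigma> k s - green \<alpha> t s * singular_weight \<sigma> l s =
        (green \<alpha> t s * s powr (- \<sigma>)) * (k s - l s)"
      using s by (simp add: singular_weight_def algebra_simps)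
    also have "norm \<dots> = (green \<alpha> t s * s powr (- \<sigma>)) * \<bar>k s - l s\<bar>"
      using green_nonneg[OF \<alpha> t s] by (simp add: abs_mult)
    also have "\<dots> \<le> (green \<alpha> t s * s powr (- \<sigma>)) * \<delta>"
      using green_nonneg[OF \<alpha> t s] \<delta>(2)[OF s] by (intro mult_left_mono) auto
    finally show "norm (green \<alpha> t s * singular_weight \<sigma> k s - green \<alpha> t s * singular_weight \<sigma> l s)
        \<le> \<delta> * (green \<alpha> t s * s powr (- \<sigma>))" by (simp add: mult.commute)
  qed (intro integrable_diff integrable_on_mult_right int)+
  also have "\<dots> = \<delta> * green_op \<alpha> (\<lambda>s. s powr (- \<sigma>)) t"
    unfolding green_op_def by simp
  also have "\<dots> \<le> \<delta> * green_max \<alpha> \<sigma>"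
    by (intro mult_left_mono green_max_upper \<alpha> \<sigma> t \<delta>)
  finally show ?thesis .
qed

theorem theorem6:
  fixes \<sigma> \<alpha> lam \<tau> :: real
    and f :: "real \<Rightarrow> real \<Rightarrow> real"
    and h :: "real \<Rightarrow> real \<Rightarrow> real"  \<comment> \<open>the continuous extension of \<open>t\<^sup>\<sigma> f(t,y)\<close> to \<open>t = 0\<close>\<close>
  assumes "0 < \<sigma>" "\<sigma> < 1" "3 < \<alpha>" "\<alpha> \<le> 4"
    and "\<And>t y. t \<in> {0<..1} \<Longrightarrow> y \<ge> 0 \<Longrightarrow> f t y \<ge> 0"
    and "continuous_on ({0<..1} \<times> {0..}) (\<lambda>(t, y). f t y)"
    and "\<And>y. y \<ge> 0 \<Longrightarrow> filterlim (\<lambda>t. f t y) at_top (at_right 0)"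
    and "\<And>t y. t \<in> {0<..1} \<Longrightarrow> y \<ge> 0 \<Longrightarrow> h t y = t powr \<sigma> * f t y"
    and "continuous_on ({0..1} \<times> {0..}) (\<lambda>(t, y). h t y)"
    and "0 < lam" "lam \<le> 1 / green_max \<alpha> \<sigma>" "0 < \<tau>"
    and "\<And>t x y. t \<in> {0..1} \<Longrightarrow> x \<ge> 0 \<Longrightarrow> y \<ge> 0 \<Longrightarrow>
           \<bar>h t x - h t y\<bar> \<le> lam * \<bar>x - y\<bar> / (1 + \<tau> * sqrt \<bar>x - y\<bar>)\<^sup>2"
  shows "\<exists>u. nonneg_solution \<alpha> f u \<and>
           (\<forall>v. nonneg_solution \<alpha> f v \<longrightarrow> (\<forall>t\<in>{0..1}. v t = u t))"
proof -
  note \<sigma> = assms(1,2) and \<alpha> = assms(3,4) and f_nonneg = assms(5) and h_eq = assms(8)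
    and h_cont = assms(9) and lam = assms(10,11) and \<tau> = assms(12) and h_contr = assms(13)
  have \<alpha>3: "\<alpha> \<ge> 3" using \<alpha> by simp
  \<comment> \<open>\<open>0 < lam \<le> 1 / green_max\<close> makes this quotient positive, which
    forces a positive denominator.\<close>
  have N: "green_max \<alpha> \<sigma> > 0"
    using lam by (metis less_le_trans zero_less_divide_1_iff)
  have hu_cont: "continuous_on {0..1} (\<lambda>s. h s (u s))"
    if "continuous_on {0..1} u" "\<forall>t\<in>{0..1}. 0 \<le> u t" for u
  proof -
    have "continuous_on {0..1} (\<lambda>s. (s, u s))"
      by (intro continuous_intros that)
    from continuous_on_compose2[OF h_cont this] that show ?thesis by auto
  qed
  \<comment> \<open>The sign of \<open>h\<close> at \<open>s = 0\<close> follows from that of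
    \<open>f\<close> at interior points by continuity.\<close>
  have hu_nonneg: "0 \<le> h s (u s)"
    if "continuous_on {0..1} u" "\<forall>t\<in>{0..1}. 0 \<le> u t" "s \<in> {0..1}" for u s
  proof -
    have "0 \<le> h s (u s)" if "s \<in> {0<..<1}" for s
      using that \<open>\<forall>t\<in>{0..1}. 0 \<le> u t\<close> h_eq[of s "u s"] f_nonneg[of s "u s"] by simp
    then show ?thesis
      using continuous_ge_on_closure[of "{0<..<1}" "\<lambda>s. h s (u s)" s 0] hu_cont[OF that(1,2)] that(3)
      by (simp add: closure_greaterThanLessThan)
  qed
  let ?g = "\<lambda>u. singular_weight \<sigma> (\<lambda>s. h s (u s))"
  define T where "T u = green_op \<alpha> (?g u)" for u
  have weight: "nonneg_integrable (?g u)"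
    if "continuous_on {0..1} u" "\<forall>t\<in>{0..1}. 0 \<le> u t" for u
    by (intro nonneg_integrable_singular_weight \<sigma> hu_cont hu_nonneg that)
  interpret gauge_contraction "{0..1::real}" T \<tau>
  proof
    show "compact {0..1::real}" by simp
    fix u v :: "real \<Rightarrow> real" and M t :: real
    assume u: "continuous_on {0..1} u" "\<forall>t\<in>{0..1}. 0 \<le> u t"
    interpret nonneg_integrable "?g u" by (rule weight[OF u])
    show "continuous_on {0..1} (T u)" unfolding T_def by (rule continuous_green_op[OF \<alpha>3])
    assume t: "t \<in> {0..1}"
    then show "0 \<le> T u t" unfolding T_def by (rule green_op_nonneg[OF \<alpha>3])
    assume v: "continuous_on {0..1} v" "\<forall>t\<in>{0..1}. 0 \<le> v t"
      and M: "0 \<le> M" "\<forall>t\<in>{0..1}. \<bar>u t - v t\<bar> \<le> M"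
    have gauge0: "contraction_gauge \<tau> M \<ge> 0" using M by (simp add: contraction_gauge_def)
    have "\<bar>T u t - T v t\<bar> \<le> (lam * contraction_gauge \<tau> M) * green_max \<alpha> \<sigma>"
      unfolding T_def
    proof (intro green_op_singular_weight_diff \<alpha>3 \<sigma> t hu_cont hu_nonneg u v)
      show "0 \<le> lam * contraction_gauge \<tau> M" using lam gauge0 by simp
      fix s :: real assume s: "s \<in> {0..1}"
      have "\<bar>h s (u s) - h s (v s)\<bar> \<le> lam * contraction_gauge \<tau> \<bar>u s - v s\<bar>"
        using h_contr[OF s, of "u s" "v s"] u v s by (simp add: contraction_gauge_def)
      also have "\<dots> \<le> lam * contraction_gauge \<tau> M"
        using M s lam \<tau> by (intro mult_left_mono contraction_gauge_mono) auto
      finally show "\<bar>h s (u s) - h s (v s)\<bar> \<le> lam * contraction_gauge \<tau> M" .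
    qed
    also have "\<dots> = (lam * green_max \<alpha> \<sigma>) * contraction_gauge \<tau> M" by simp
    \<comment> \<open>Here \<open>lam \<le> 1 / green_max\<close> makes the constant at most 1,
      leaving the gauge alone.\<close>
    also have "\<dots> \<le> 1 * contraction_gauge \<tau> M"
      using lam N gauge0 by (intro mult_right_mono) (simp_all add: field_simps)
    finally show "\<bar>T u t - T v t\<bar> \<le> contraction_gauge \<tau> M" by simp
  qed (rule \<tau>)
  have T_solves: "has_RL_derivative \<alpha> (T u) (f t (u t)) t"
    if u: "continuous_on {0..1} u" "\<forall>t\<in>{0..1}. 0 \<le> u t" and t: "t \<in> {0<..<1}" for u t
  proof -
    interpret nonneg_integrable "?g u" by (rule weight[OF u])
    have "?g u t = f t (u t)"
      using t u h_eq[of t "u t"]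
      by (simp add: singular_weight_def mult.assoc[symmetric] powr_add[symmetric])
    then show ?thesis
      using green_op_has_RL_derivative[OF \<alpha> isCont_singular_weight[OF hu_cont[OF u]] t]
      by (simp add: T_def)
  qed
  have T_boundary: "T u 0 = 0" "T u 1 = 0"
      "(T u has_real_derivative 0) (at_right 0)" "(T u has_real_derivative 0) (at_left 1)"
    if u: "continuous_on {0..1} u" "\<forall>t\<in>{0..1}. 0 \<le> u t" for u
  proof -
    interpret nonneg_integrable "?g u" by (rule weight[OF u])
    show "T u 0 = 0" "T u 1 = 0"
      "(T u has_real_derivative 0) (at_right 0)" "(T u has_real_derivative 0) (at_left 1)"
      unfolding T_def using green_op_boundary[OF \<alpha>(1)] by blast+
  qed
  have solution_fixed: "\<forall>t\<in>{0..1}. T v t = v t" if "nonneg_solution \<alpha> f v" for v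
  proof
    note v = that[unfolded nonneg_solution_def]
    have v': "continuous_on {0..1} v" "\<forall>t\<in>{0..1}. 0 \<le> v t" using v by auto
    fix t :: real assume "t \<in> {0..1}"
    then show "T v t = v t"
    proof (rule boundary_value_problem_unique[OF \<alpha> T_continuous[OF v'] v'(1),
          where d="\<lambda>t. f t (v t)" and e=0 and e'=0, rotated -1])
      show "T v 0 = v 0" "T v 1 = v 1" using T_boundary(1,2)[OF v'] v by simp_all
    qed (use v T_solves[OF v'] T_boundary(3,4)[OF v'] in blast)+
  qed
  obtain w where w: "continuous_on {0..1} w" "\<forall>t\<in>{0..1}. 0 \<le> w t" "\<forall>t\<in>{0..1}. T w t = w t"
    using fixed_point_exists by blast
  have w': "\<forall>t\<in>{0..1}. 0 \<le> T w t" using w by simp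
  \<comment> \<open>Choosing \<open>T w\<close>, which equals \<open>w\<close> only on the unit interval, avoids transferring
    derivatives from \<open>T w\<close> to \<open>w\<close>.\<close>
  have "nonneg_solution \<alpha> f (T w)"
    unfolding nonneg_solution_def
    using T_continuous[OF w(1,2)] w' T_solves[OF w(1,2)] T_boundary[OF w(1,2)] w(3) by auto
  moreover have "v t = T w t" if v: "nonneg_solution \<alpha> f v" and t: "t \<in> {0..1}" for v t
  proof -
    have "v t = w t"
      using v solution_fixed[OF v] w t
      by (intro fixed_point_unique) (auto simp: nonneg_solution_def)
    then show ?thesis using w(3) t by simp
  qed
  ultimately show ?thesis by blast
qed

end
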